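(* Each of the following sets is $\Sigma^0_1$-complete: (a) the set of finite TRSs $R$ that are weakly confluent (weakly confluent on every term, including open terms); (b) the set of pairs $(R,t)$, $R$ a finite TRS and $t$ a term, such that $R$ is weakly confluent on $t$; (c) the set of pairs $(R,t)$, $R$ a finite TRS and $t$ a ground term, such that $R$ is weakly confluent on $t$.
   Context: All TRSs are finite sets of rules over a finite signature; terms may contain variables, ground terms contain none. A TRS $R$ is weakly confluent on a term $t$ if for all terms $t_1,t_2$ with $t_1\leftarrow_R t\to_R t_2$ (single steps) there is a term $d$ with $t_1\to_R^* d\leftarrow_R^* t_2$. TRSs and terms are encoded as natural numbers by a standard effective Gödel numbering, and properties are identified with the corresponding sets of codes. $\Sigma^0_n,\Pi^0_n$ are the classes of the arithmetical hierarchy; a set $B$ is $\mathcal P$-complete if $B\in\mathcal P$ and every $A\in\mathcal P$ is many-one reducible to $B$ via a total computable function. *)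

theory Defs
  imports Main "HOL-Library.Nat_Bijection"
begin

datatype recf =
    Zr
  | Sc
  | Pj nat
  | Cn recf "recf list"
  | Pr recf recf
  | Mn recf

inductive eval :: "recf \<Rightarrow> nat list \<Rightarrow> nat \<Rightarrow> bool" where
  eval_Zr: "eval Zr xs 0"
| eval_Sc: "eval Sc (x # xs) (Suc x)"
| eval_Pj: "i < length xs \<Longrightarrow> eval (Pj i) xs (xs ! i)"
| eval_Cn: "list_all2 (\<lambda>g y. eval g xs y) gs ys \<Longrightarrow> eval f ys y \<Longrightarrow> eval (Cn f gs) xs y"
| eval_Pr0: "eval f xs y \<Longrightarrow> eval (Pr f g) (0 # xs) y"
| eval_PrS: "eval (Pr f g) (k # xs) r \<Longrightarrow> eval g (k # r # xs) y \<Longrightarrow> eval (Pr f g) (Suc k # xs) y"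
| eval_Mn: "eval f (y # xs) 0 \<Longrightarrow> (\<And>z. z < y \<Longrightarrow> \<exists>v. eval f (z # xs) v \<and> v \<noteq> 0)
             \<Longrightarrow> eval (Mn f) xs y"

monos list_all2_mono

definition total_computable :: "(nat \<Rightarrow> nat) \<Rightarrow> bool" where
  "total_computable f \<longleftrightarrow> (\<exists>p. \<forall>x. eval p [x] (f x))"

text \<open>Sigma^0_1 = recursively enumerable = domain of a partial recursive function.\<close>
definition Sigma01 :: "nat set set" where
  "Sigma01 = {A. \<exists>p. \<forall>x. x \<in> A \<longleftrightarrow> (\<exists>y. eval p [x] y)}"

definition many_one_reducible :: "nat set \<Rightarrow> nat set \<Rightarrow> bool" where
  "many_one_reducible A B \<longleftrightarrow> (\<exists>f. total_computable f \<and> (\<forall>x. x \<in> A \<longleftrightarrow> f x \<in> B))"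

definition complete_for :: "nat set set \<Rightarrow> nat set \<Rightarrow> bool" where
  "complete_for P B \<longleftrightarrow> B \<in> P \<and> (\<forall>A\<in>P. many_one_reducible A B)"

datatype trm = Var nat | Fun nat "trm list"

fun vars :: "trm \<Rightarrow> nat set" where
  "vars (Var x) = {x}"
| "vars (Fun f ts) = (\<Union>t\<in>set ts. vars t)"

definition ground :: "trm \<Rightarrow> bool" where
  "ground t \<longleftrightarrow> vars t = {}"

fun subst :: "(nat \<Rightarrow> trm) \<Rightarrow> trm \<Rightarrow> trm" where
  "subst \<sigma> (Var x) = \<sigma> x"
| "subst \<sigma> (Fun f ts) = Fun f (map (subst \<sigma>) ts)"

type_synonym trs = "(trm \<times> trm) set"

definition is_trs :: "trs \<Rightarrow> bool" where
  "is_trs R \<longleftrightarrow> finite R \<and> (\<forall>(l, r)\<in>R. (\<exists>f ts. l = Fun f ts) \<and> vars r \<subseteq> vars l)"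

inductive rstep :: "trs \<Rightarrow> trm \<Rightarrow> trm \<Rightarrow> bool" for R where
  root: "(l, r) \<in> R \<Longrightarrow> rstep R (subst \<sigma> l) (subst \<sigma> r)"
| ctxt: "rstep R s t \<Longrightarrow> rstep R (Fun f (ss @ s # us)) (Fun f (ss @ t # us))"

definition weakly_confluent_on :: "trs \<Rightarrow> trm \<Rightarrow> bool" where
  "weakly_confluent_on R t \<longleftrightarrow>
     (\<forall>t1 t2. rstep R t t1 \<and> rstep R t t2 \<longrightarrow>
        (\<exists>d. (rstep R)\<^sup>*\<^sup>* t1 d \<and> (rstep R)\<^sup>*\<^sup>* t2 d))"

definition weakly_confluent :: "trs \<Rightarrow> bool" where
  "weakly_confluent R \<longleftrightarrow> (\<forall>t. weakly_confluent_on R t)"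

fun enc_term :: "trm \<Rightarrow> nat" where
  "enc_term (Var x) = prod_encode (0, x)"
| "enc_term (Fun f ts) = prod_encode (1, prod_encode (f, list_encode (map enc_term ts)))"

definition enc_trs :: "(trm \<times> trm) list \<Rightarrow> nat" where
  "enc_trs rs = list_encode (map (\<lambda>(l, r). prod_encode (enc_term l, enc_term r)) rs)"

definition WCR_set :: "nat set" where
  "WCR_set = {enc_trs rs | rs. is_trs (set rs) \<and> weakly_confluent (set rs)}"

definition WCR_on_set :: "nat set" where
  "WCR_on_set = {prod_encode (enc_trs rs, enc_term t) | rs t.
                   is_trs (set rs) \<and> weakly_confluent_on (set rs) t}"

definition WCR_on_ground_set :: "nat set" where
  "WCR_on_ground_set = {prod_encode (enc_trs rs, enc_term t) | rs t.
                   is_trs (set rs) \<and> ground t \<and> weakly_confluent_on (set rs) t}"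

end

theory Submission
  imports Defs
begin

text \<open>
  Membership: by the critical pair lemma, weak confluence only has to be checked on overlaps of rules.
  Instead of most general unifiers one can use the finite set of all iterated bindings of variables to
  subterms, since every unifier factors through one of them; joinability of the resulting finitely many
  peaks has a finite certificate.  For a single term the finitely many one-step reducts are found by
  the same enumeration of bindings.

  Hardness: a fixed orthogonal rewrite system runs a continuation-passing interpreter for recursive
  functions, so that every state rewrites at its root only and deterministically.  Adding the rules
  \<open>Start \<rightarrow> run p x\<close> and \<open>Start \<rightarrow> Done\<close> creates a single overlap, which is joinable if and only if
  the program \<open>p\<close> halts on \<open>x\<close>.
\<close>

section \<open>Total computable functions\<close>

text \<open>Membership must end in an actual program of type \<open>recf\<close>, and programming
  unification or rewriting by hand would be unmanageable. Only pairing, arithmetic and primitive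
  recursion are programmed. Above that level semidecidability is a closure property derived by
  introduction rules, and a function counts as computable once its graph is semidecidable. Finite
  derivations make inductively defined predicates semidecidable, so recursive functions on lists and
  terms need no programs of their own. Negation is not among the closure properties. Conditions of
  the form "if these terms are equal, then ..." are therefore phrased over finite lists of
  candidates, with an inequality of codes as the alternative. For hardness, weak confluence has to
  hold on all terms, also on those that never arise in a computation. Hence the interpreter keeps
  its pending work as inert constructor data instead of nested calls, so that no left-hand side has
  another redex below its root. The program is a fixed part of the system and only the input varies:
  the reduction merely writes a numeral into the code of one rule.\<close>

inductive_cases eval_ZrE: "eval Zr xs y"
inductive_cases eval_ScE: "eval Sc xs y"
inductive_cases eval_PjE: "eval (Pj i) xs y"
inductive_cases eval_CnE: "eval (Cn f gs) xs y"
inductive_cases eval_PrE0: "eval (Pr f g) (0 # xs) y"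
inductive_cases eval_PrES: "eval (Pr f g) (Suc k # xs) y"
inductive_cases eval_MnE: "eval (Mn f) xs y"

lemma eval_deterministic: "eval p xs y \<Longrightarrow> eval p xs z \<Longrightarrow> y = z"
proof (induction arbitrary: z rule: eval.induct)
  case (eval_Zr xs)
  then show ?case by (auto elim: eval_ZrE)
next
  case (eval_Sc x xs)
  then show ?case by (auto elim: eval_ScE)
next
  case (eval_Pj i xs)
  then show ?case by (auto elim: eval_PjE)
next
  case (eval_Cn xs gs ys f y)
  from eval_Cn.prems obtain zs where zs: "list_all2 (\<lambda>g z. eval g xs z) gs zs" "eval f zs z"
    by (auto elim: eval_CnE)
  have "ys = zs"
    using eval_Cn.IH(1) zs(1) by (auto simp: list_all2_conv_all_nth intro!: nth_equalityI)
  then show ?case using eval_Cn.IH(2) zs(2) by simp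
next
  case (eval_Pr0 f xs y g)
  from eval_Pr0.prems have "eval f xs z" by (rule eval_PrE0)
  then show ?case by (rule eval_Pr0.IH)
next
  case (eval_PrS f g k xs r y)
  from eval_PrS.prems obtain r' where "eval (Pr f g) (k # xs) r'" "eval g (k # r' # xs) z"
    by (rule eval_PrES)
  then show ?case using eval_PrS.IH by blast
next
  case (eval_Mn f y xs)
  from eval_Mn.prems have z: "eval f (z # xs) 0" "\<And>u. u < z \<Longrightarrow> \<exists>v. eval f (u # xs) v \<and> v \<noteq> 0"
    by (rule eval_MnE, blast)+
  show ?case
  proof (cases y z rule: linorder_cases)
    case less
    then show ?thesis using z(2) eval_Mn.IH(1) by blast
  next
    case greater
    then show ?thesis using z(1) eval_Mn.IH(2) by blast
  qed
qed

lemma eval_Cn1: "eval g xs a \<Longrightarrow> eval f [a] y \<Longrightarrow> eval (Cn f [g]) xs y"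
  by (rule eval_Cn[where ys = "[a]"]) auto

lemma eval_Cn2:
  "eval g xs a \<Longrightarrow> eval h xs b \<Longrightarrow> eval f [a, b] y \<Longrightarrow> eval (Cn f [g, h]) xs y"
  by (rule eval_Cn[where ys = "[a, b]"]) auto

lemma eval_Pj_eq: "i < length xs \<Longrightarrow> y = xs ! i \<Longrightarrow> eval (Pj i) xs y"
  using eval_Pj by simp

lemma eval_Sc_eq: "y = Suc x \<Longrightarrow> eval Sc (x # xs) y"
  using eval_Sc by simp

text \<open>Binary functions are the stepping stone to pairing; with pairing available, several
  arguments are packed into one number.\<close>

definition computable2 :: "(nat \<Rightarrow> nat \<Rightarrow> nat) \<Rightarrow> bool" where
  "computable2 g \<longleftrightarrow> (\<exists>p. \<forall>x y. eval p [x, y] (g x y))"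

lemma computable2_add: "computable2 (+)"
proof -
  let ?p = "Pr (Pj 0) (Cn Sc [Pj 1])"
  have "eval ?p [x, y] (x + y)" for x y
  proof (induction x)
    case 0
    show ?case by (rule eval_Pr0) (simp add: eval_Pj_eq)
  next
    case (Suc x)
    show ?case
      by (rule eval_PrS[OF Suc], rule eval_Cn1[where a = "x + y"]) (simp_all add: eval_Pj_eq eval_Sc_eq)
  qed
  then show ?thesis unfolding computable2_def by blast
qed

lemma total_computable_pred: "total_computable (\<lambda>x. x - 1)"
proof -
  have "eval (Pr Zr (Pj 0)) [x] (x - 1)" for x
  proof (induction x)
    case 0
    show ?case by (rule eval_Pr0) (simp add: eval_Zr)
  next
    case (Suc x)
    show ?case by (rule eval_PrS[OF Suc]) (simp add: eval_Pj_eq)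
  qed
  then show ?thesis unfolding total_computable_def by blast
qed

text \<open>The arguments are swapped because \<open>Pr\<close> recurses on its first argument,
  which has to be the subtrahend.\<close>

lemma computable2_diff: "computable2 (\<lambda>x y. y - x)"
proof -
  obtain q where q: "\<And>x. eval q [x] (x - 1)"
    using total_computable_pred unfolding total_computable_def by blast
  have "eval (Pr (Pj 0) (Cn q [Pj 1])) [x, y] (y - x)" for x y
  proof (induction x)
    case 0
    show ?case by (rule eval_Pr0) (simp add: eval_Pj_eq)
  next
    case (Suc x)
    show ?case
      by (rule eval_PrS[OF Suc], rule eval_Cn1[where a = "y - x"])
        (use q[of "y - x"] in \<open>simp_all add: eval_Pj_eq\<close>)
  qed
  then show ?thesis unfolding computable2_def by blast
qed

lemma computable2_mult: "computable2 (*)"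
proof -
  obtain q where q: "\<And>x y. eval q [x, y] (x + y)"
    using computable2_add unfolding computable2_def by blast
  have "eval (Pr Zr (Cn q [Pj 2, Pj 1])) [x, y] (x * y)" for x y
  proof (induction x)
    case 0
    show ?case by (rule eval_Pr0) (simp add: eval_Zr)
  next
    case (Suc x)
    show ?case
      by (rule eval_PrS[OF Suc], rule eval_Cn2[where a = y and b = "x * y"])
        (use q[of y "x * y"] in \<open>simp_all add: eval_Pj_eq\<close>)
  qed
  then show ?thesis unfolding computable2_def by blast
qed

lemma total_computable_id: "total_computable (\<lambda>x. x)"
  unfolding total_computable_def by (rule exI[of _ "Pj 0"]) (simp add: eval_Pj_eq)

lemma total_computable_comp:
  assumes "total_computable g" "total_computable f"
  shows "total_computable (\<lambda>x. g (f x))"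
proof -
  obtain p q where "\<And>x. eval p [x] (g x)" "\<And>x. eval q [x] (f x)"
    using assms unfolding total_computable_def by blast
  then have "\<forall>x. eval (Cn p [q]) [x] (g (f x))" by (blast intro: eval_Cn1)
  then show ?thesis unfolding total_computable_def by blast
qed

lemma total_computable_comp2:
  assumes "computable2 g" "total_computable a" "total_computable b"
  shows "total_computable (\<lambda>x. g (a x) (b x))"
proof -
  obtain p q r where "\<And>x y. eval p [x, y] (g x y)" "\<And>x. eval q [x] (a x)" "\<And>x. eval r [x] (b x)"
    using assms unfolding total_computable_def computable2_def by blast
  then have "\<forall>x. eval (Cn p [q, r]) [x] (g (a x) (b x))" by (blast intro: eval_Cn2)
  then show ?thesis unfolding total_computable_def by blast
qed

lemma total_computable_Suc: "total_computable f \<Longrightarrow> total_computable (\<lambda>x. Suc (f x))"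
  by (rule total_computable_comp[of Suc])
    (auto simp: total_computable_def intro!: exI[of _ Sc] eval_Sc)

lemma total_computable_const: "total_computable (\<lambda>_. c)"
proof (induction c)
  case 0
  then show ?case unfolding total_computable_def by (rule_tac exI[of _ Zr]) (simp add: eval_Zr)
qed (rule total_computable_Suc)

lemma total_computable_triangle: "total_computable triangle"
proof -
  obtain q where q: "\<And>x y. eval q [x, y] (x + y)"
    using computable2_add unfolding computable2_def by blast
  have "eval (Pr Zr (Cn Sc [Cn q [Pj 0, Pj 1]])) [x] (triangle x)" for x
  proof (induction x)
    case 0
    show ?case by (rule eval_Pr0) (simp add: eval_Zr)
  next
    case (Suc x)
    have "eval (Cn q [Pj 0, Pj 1]) [x, triangle x] (x + triangle x)"
      by (rule eval_Cn2[OF _ _ q]) (simp_all add: eval_Pj_eq)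
    then show ?case
      by (intro eval_PrS[OF Suc] eval_Cn1[where a = "x + triangle x"]) (simp_all add: eval_Sc_eq)
  qed
  then show ?thesis unfolding total_computable_def by blast
qed

lemma computable2_prod_encode: "computable2 (\<lambda>x y. prod_encode (x, y))"
proof -
  obtain q where q: "\<And>x y. eval q [x, y] (x + y)"
    using computable2_add unfolding computable2_def by blast
  obtain t where t: "\<And>x. eval t [x] (triangle x)"
    using total_computable_triangle unfolding total_computable_def by blast
  have "eval (Cn q [Cn t [q], Pj 0]) [x, y] (triangle (x + y) + x)" for x y
    by (rule eval_Cn2[OF eval_Cn1[OF q t] _ q]) (simp add: eval_Pj_eq)
  then show ?thesis unfolding computable2_def prod_encode_def by auto
qed

abbreviation (input) pfst :: "nat \<Rightarrow> nat" where "pfst n \<equiv> fst (prod_decode n)"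
abbreviation (input) psnd :: "nat \<Rightarrow> nat" where "psnd n \<equiv> snd (prod_decode n)"

lemma mono_triangle: "x \<le> y \<Longrightarrow> triangle x \<le> triangle y"
  by (induction rule: dec_induct) auto

text \<open>Since \<open>prod_encode (a, b) = triangle (a + b) + a\<close>, the sum
  \<open>a + b\<close> is the least \<open>y\<close> with \<open>n < triangle (Suc y)\<close>, which
  \<open>Mn\<close> finds. Both components of the pair are then recovered by subtraction.\<close>

lemma total_computable_diagonal:
  "total_computable (\<lambda>n. pfst n + psnd n)"
proof -
  obtain q where q: "\<And>x y. eval q [x, y] (y - x)"
    using computable2_diff unfolding computable2_def by blast
  obtain t where t: "\<And>x. eval t [x] (triangle (Suc x))"
    using total_computable_comp[OF total_computable_triangle total_computable_Suc[OF total_computable_id]]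
    unfolding total_computable_def by blast
  let ?p = "Cn q [Cn t [Pj 0], Cn Sc [Pj 1]]"
  have p: "eval ?p [y, n] (Suc n - triangle (Suc y))" for y n
    by (rule eval_Cn2[OF eval_Cn1[OF _ t] eval_Cn1[OF _ eval_Sc] q])
      (simp_all add: eval_Pj_eq)
  have "eval (Mn ?p) [prod_encode (a, b)] (a + b)" for a b
  proof (rule eval_Mn)
    show "eval ?p [a + b, prod_encode (a, b)] 0"
      using p[of "a + b" "prod_encode (a, b)"] by (simp add: prod_encode_def)
  next
    fix z assume "z < a + b"
    then have "triangle (Suc z) \<le> triangle (a + b)" by (intro mono_triangle) simp
    then have "Suc (prod_encode (a, b)) - triangle (Suc z) \<noteq> 0" by (simp add: prod_encode_def)
    then show "\<exists>v. eval ?p [z, prod_encode (a, b)] v \<and> v \<noteq> 0" using p by blast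
  qed
  then have "eval (Mn ?p) [n] (pfst n + psnd n)" for n
    by (metis prod.collapse prod_decode_inverse)
  then show ?thesis unfolding total_computable_def by blast
qed

lemma total_computable_pair:
  "total_computable f \<Longrightarrow> total_computable g \<Longrightarrow> total_computable (\<lambda>x. prod_encode (f x, g x))"
  by (rule total_computable_comp2[OF computable2_prod_encode])

lemma total_computable_add:
  "total_computable f \<Longrightarrow> total_computable g \<Longrightarrow> total_computable (\<lambda>x. f x + g x)"
  by (rule total_computable_comp2[OF computable2_add])

lemma total_computable_mult:
  "total_computable f \<Longrightarrow> total_computable g \<Longrightarrow> total_computable (\<lambda>x. f x * g x)"
  by (rule total_computable_comp2[OF computable2_mult])

lemma total_computable_diff:
  "total_computable f \<Longrightarrow> total_computable g \<Longrightarrow> total_computable (\<lambda>x. f x - g x)"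
  by (rule total_computable_comp2[OF computable2_diff])

lemma total_computable_pfst:
  assumes "total_computable f"
  shows "total_computable (\<lambda>x. pfst (f x))"
proof -
  have "n - triangle (pfst n + psnd n) = pfst n" for n
    using prod_decode_inverse[of n] by (simp add: prod_encode_def case_prod_beta)
  then have "total_computable pfst"
    using total_computable_diff[OF total_computable_id
        total_computable_comp[OF total_computable_triangle total_computable_diagonal]]
    by simp
  then show ?thesis using assms by (rule total_computable_comp)
qed

lemma total_computable_psnd:
  assumes "total_computable f"
  shows "total_computable (\<lambda>x. psnd (f x))"
proof -
  have "total_computable psnd"
    using total_computable_diff[OF total_computable_diagonal total_computable_pfst[OF total_computable_id]]
    by simp
  then show ?thesis using assms by (rule total_computable_comp)
qed

text \<open>Stated for \<open>rec_nat\<close> so that computability of a recursion follows by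
  introduction rules from the shape of the HOL term. The step is one unary program that receives
  parameter, counter and previous value as a coded triple.\<close>

lemma total_computable_rec_nat:
  assumes a: "total_computable a"
    and b: "total_computable (\<lambda>z. b (pfst z) (pfst (psnd z)) (psnd (psnd z)))"
    and n: "total_computable n"
  shows "total_computable (\<lambda>x. rec_nat (a x) (b x) (n x))"
proof -
  obtain p where p: "\<And>x. eval p [x] (a x)"
    using a unfolding total_computable_def by blast
  obtain q where q: "\<And>z. eval q [z] (b (pfst z) (pfst (psnd z)) (psnd (psnd z)))"
    using b unfolding total_computable_def by blast
  obtain e where e: "\<And>x y. eval e [x, y] (prod_encode (x, y))"
    using computable2_prod_encode unfolding computable2_def by blast
  let ?q = "Cn q [Cn e [Pj 2, Cn e [Pj 0, Pj 1]]]"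
  have q': "eval ?q [k, r, x] (b x k r)" for k r x
  proof -
    have "eval (Cn e [Pj 2, Cn e [Pj 0, Pj 1]]) [k, r, x] (prod_encode (x, prod_encode (k, r)))"
      by (rule eval_Cn2[OF _ eval_Cn2[OF _ _ e] e]) (simp_all add: eval_Pj_eq)
    from eval_Cn1[OF this q] show ?thesis by simp
  qed
  have "eval (Pr p ?q) [k, x] (rec_nat (a x) (b x) k)" for k x
  proof (induction k)
    case 0
    show ?case using p by (simp add: eval_Pr0)
  next
    case (Suc k)
    show ?case using eval_PrS[OF Suc q'] by simp
  qed
  then have "computable2 (\<lambda>k x. rec_nat (a x) (b x) k)" unfolding computable2_def by blast
  from total_computable_comp2[OF this n total_computable_id] show ?thesis .
qed

lemmas total_computable_intros =
  total_computable_id total_computable_const total_computable_Suc total_computable_pair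
  total_computable_add total_computable_mult total_computable_diff total_computable_pfst
  total_computable_psnd total_computable_rec_nat

section \<open>Semidecidable predicates on numbers\<close>

text \<open>The test \<open>d\<close> is total and accepts by the value \<open>0\<close>. With total
  tests, logical connectives become arithmetic on their values, and no computations have to be
  interleaved.\<close>

definition sigma :: "(nat \<Rightarrow> bool) \<Rightarrow> bool" where
  "sigma P \<longleftrightarrow> (\<exists>d. total_computable d \<and> (\<forall>x. P x \<longleftrightarrow> (\<exists>y. d (prod_encode (x, y)) = 0)))"

lemma sigmaI:
  assumes "total_computable d" "\<And>x. P x \<longleftrightarrow> (\<exists>y. d (prod_encode (x, y)) = 0)"
  shows "sigma P"
  using assms unfolding sigma_def by blast

lemma sigmaE:
  assumes "sigma P"
  obtains d where "total_computable d" "\<And>x. P x \<longleftrightarrow> (\<exists>y. d (prod_encode (x, y)) = 0)"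
  using assms unfolding sigma_def by blast

text \<open>\<open>Mn\<close> searches for the least accepted witness. Totality of the test supplies
  the nonzero values that \<open>eval_Mn\<close> demands at all smaller candidates; determinism of
  \<open>eval\<close> turns a halting search back into a witness.\<close>

lemma Collect_sigma_in_Sigma01:
  assumes "sigma P"
  shows "{x. P x} \<in> Sigma01"
proof -
  obtain d where d: "total_computable d" "\<And>x. P x \<longleftrightarrow> (\<exists>y. d (prod_encode (x, y)) = 0)"
    using assms by (rule sigmaE) blast
  obtain p where p: "\<And>x. eval p [x] (d x)"
    using d(1) unfolding total_computable_def by blast
  obtain e where e: "\<And>x y. eval e [x, y] (prod_encode (x, y))"
    using computable2_prod_encode unfolding computable2_def by blast
  let ?q = "Cn p [Cn e [Pj 1, Pj 0]]"
  have q: "eval ?q [y, x] (d (prod_encode (x, y)))" for x y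
    by (rule eval_Cn1[OF eval_Cn2[OF _ _ e] p]) (simp_all add: eval_Pj_eq)
  have "P x \<longleftrightarrow> (\<exists>y. eval (Mn ?q) [x] y)" for x
  proof
    assume "P x"
    then have ex: "\<exists>y. d (prod_encode (x, y)) = 0" using d(2) by simp
    define y where "y = (LEAST y. d (prod_encode (x, y)) = 0)"
    have "d (prod_encode (x, y)) = 0" unfolding y_def using ex by (rule LeastI_ex)
    moreover have "d (prod_encode (x, z)) \<noteq> 0" if "z < y" for z
      using that unfolding y_def by (rule not_less_Least)
    ultimately have "eval (Mn ?q) [x] y" using q[of _ x] by (metis eval_Mn)
    then show "\<exists>y. eval (Mn ?q) [x] y" ..
  next
    assume "\<exists>y. eval (Mn ?q) [x] y"
    then obtain y where "eval ?q [y, x] 0" by (blast elim: eval_MnE)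
    then show "P x" using q d(2) eval_deterministic by metis
  qed
  then show ?thesis unfolding Sigma01_def by blast
qed

lemma sigma_eq:
  assumes "total_computable f" "total_computable g"
  shows "sigma (\<lambda>x. f x = g x)"
proof (rule sigmaI)
  show "total_computable (\<lambda>z. (f (pfst z) - g (pfst z)) + (g (pfst z) - f (pfst z)))"
    by (intro total_computable_intros total_computable_comp[OF assms(1)] total_computable_comp[OF assms(2)])
qed auto

text \<open>A rule of its own, because \<open>sigma\<close> is not closed under complement;
  comparing two computed numbers is decidable.\<close>

lemma sigma_neq:
  assumes "total_computable f" "total_computable g"
  shows "sigma (\<lambda>x. f x \<noteq> g x)"
proof (rule sigmaI)
  show "total_computable (\<lambda>z. 1 - ((f (pfst z) - g (pfst z)) + (g (pfst z) - f (pfst z))))"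
    by (intro total_computable_intros total_computable_comp[OF assms(1)] total_computable_comp[OF assms(2)])
qed auto

lemma sigma_subst:
  assumes "sigma P" "total_computable f"
  shows "sigma (\<lambda>x. P (f x))"
proof -
  obtain d where d: "total_computable d" "\<And>x. P x \<longleftrightarrow> (\<exists>y. d (prod_encode (x, y)) = 0)"
    using assms(1) by (rule sigmaE) blast
  show ?thesis
  proof (rule sigmaI)
    show "total_computable (\<lambda>z. d (prod_encode (f (pfst z), psnd z)))"
      by (intro total_computable_comp[OF d(1)] total_computable_intros
          total_computable_comp[OF assms(2)])
  qed (simp add: d(2))
qed

lemma ex_prod_decode: "(\<exists>w. P (pfst w) (psnd w)) \<longleftrightarrow> (\<exists>y z. P y z)"
  by (metis fst_conv prod_encode_inverse snd_conv)

text \<open>A sum of tests vanishes iff both tests do, and the two witnesses travel as a coded pair.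
  For disjunction a product with one shared witness is enough.\<close>

lemma sigma_conj:
  assumes "sigma P" "sigma Q"
  shows "sigma (\<lambda>x. P x \<and> Q x)"
proof -
  obtain d where d: "total_computable d" "\<And>x. P x \<longleftrightarrow> (\<exists>y. d (prod_encode (x, y)) = 0)"
    using assms(1) by (rule sigmaE) blast
  obtain e where e: "total_computable e" "\<And>x. Q x \<longleftrightarrow> (\<exists>y. e (prod_encode (x, y)) = 0)"
    using assms(2) by (rule sigmaE) blast
  show ?thesis
  proof (rule sigmaI)
    show "total_computable (\<lambda>z. d (prod_encode (pfst z, pfst (psnd z)))
        + e (prod_encode (pfst z, psnd (psnd z))))"
      by (intro total_computable_intros total_computable_comp[OF d(1)] total_computable_comp[OF e(1)])
  qed (simp add: d(2) e(2) ex_prod_decode[of "\<lambda>y z. d (prod_encode (_, y)) = 0 \<and> e (prod_encode (_, z)) = 0"])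
qed

lemma sigma_disj:
  assumes "sigma P" "sigma Q"
  shows "sigma (\<lambda>x. P x \<or> Q x)"
proof -
  obtain d where d: "total_computable d" "\<And>x. P x \<longleftrightarrow> (\<exists>y. d (prod_encode (x, y)) = 0)"
    using assms(1) by (rule sigmaE) blast
  obtain e where e: "total_computable e" "\<And>x. Q x \<longleftrightarrow> (\<exists>y. e (prod_encode (x, y)) = 0)"
    using assms(2) by (rule sigmaE) blast
  show ?thesis
  proof (rule sigmaI)
    show "total_computable (\<lambda>z. d z * e z)"
      by (intro total_computable_intros d(1) e(1))
  qed (auto simp: d(2) e(2))
qed

lemma sigma_ex:
  assumes "sigma (\<lambda>z. P (pfst z) (psnd z))"
  shows "sigma (\<lambda>x. \<exists>y. P x y)"
proof -
  obtain d where d: "total_computable d"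
    "\<And>x. P (pfst x) (psnd x) \<longleftrightarrow> (\<exists>y. d (prod_encode (x, y)) = 0)"
    using assms(1) by (rule sigmaE) blast
  have P: "P x y \<longleftrightarrow> (\<exists>z. d (prod_encode (prod_encode (x, y), z)) = 0)" for x y
    using d(2)[of "prod_encode (x, y)"] by simp
  show ?thesis
  proof (rule sigmaI)
    show "total_computable (\<lambda>z. d (prod_encode (prod_encode (pfst z, pfst (psnd z)), psnd (psnd z))))"
      by (intro total_computable_comp[OF d(1)] total_computable_intros)
  qed (simp add: P ex_prod_decode[of "\<lambda>y z. d (prod_encode (prod_encode (_, y), z)) = 0"])
qed

section \<open>Reading lists through their codes\<close>

definition tl_code :: "nat \<Rightarrow> nat" where
  "tl_code n = psnd (n - 1)"

definition drop_code :: "nat \<Rightarrow> nat \<Rightarrow> nat" where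
  "drop_code n i = rec_nat n (\<lambda>_. tl_code) i"

definition nth_code :: "nat \<Rightarrow> nat \<Rightarrow> nat" where
  "nth_code n i = pfst (drop_code n i - 1)"

lemma total_computable_drop_code:
  "total_computable f \<Longrightarrow> total_computable g \<Longrightarrow> total_computable (\<lambda>x. drop_code (f x) (g x))"
  unfolding drop_code_def tl_code_def by (intro total_computable_intros)

lemma total_computable_nth_code:
  "total_computable f \<Longrightarrow> total_computable g \<Longrightarrow> total_computable (\<lambda>x. nth_code (f x) (g x))"
  unfolding nth_code_def by (intro total_computable_intros total_computable_drop_code)

lemma drop_code_list_encode: "drop_code (list_encode xs) i = list_encode (drop i xs)"
proof (induction i)
  case (Suc i)
  \<comment> \<open>The empty list has code \<open>0\<close>. Truncated subtraction leaves
    \<open>0\<close> unchanged and \<open>0\<close> decodes to a pair of zeros, so dropping from the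
    empty list stays at the empty list.\<close>
  have "prod_decode 0 = (0, 0)"
    using prod_encode_inverse[of "(0, 0)"] by (simp add: prod_encode_def)
  then have "psnd (list_encode ys - 1) = list_encode (tl ys)" for ys
    by (cases ys) simp_all
  then show ?case using Suc by (simp add: drop_code_def tl_code_def drop_Suc tl_drop)
qed (simp add: drop_code_def)

lemma nth_code_list_encode: "i < length xs \<Longrightarrow> nth_code (list_encode xs) i = xs ! i"
  by (simp add: nth_code_def drop_code_list_encode Cons_nth_drop_Suc[symmetric])

text \<open>Lets the code itself bound the positions of a list, so that no length function has to be
  computed.\<close>

lemma length_le_list_encode: "length xs \<le> list_encode xs"
proof (induction xs)
  case (Cons x xs)
  then show ?case using le_prod_encode_2[of "list_encode xs" x] by simp
qed simp

text \<open>Collection: the finitely many witnesses for \<open>i < n x\<close> are gathered into one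
  coded list, which becomes the single witness, and the tests are summed by primitive
  recursion.\<close>

lemma sigma_all_less:
  assumes "sigma (\<lambda>z. P (pfst z) (psnd z))" "total_computable n"
  shows "sigma (\<lambda>x. \<forall>i < n x. P x i)"
proof -
  obtain d where d: "total_computable d"
    "\<And>x. P (pfst x) (psnd x) \<longleftrightarrow> (\<exists>y. d (prod_encode (x, y)) = 0)"
    using assms(1) by (rule sigmaE) blast
  have P: "P x y \<longleftrightarrow> (\<exists>z. d (prod_encode (prod_encode (x, y), z)) = 0)" for x y
    using d(2)[of "prod_encode (x, y)"] by simp
  let ?e = "\<lambda>x w i. d (prod_encode (prod_encode (x, i), nth_code w i))"
  have sum: "rec_nat 0 (\<lambda>i r. r + ?e x w i) m = 0 \<longleftrightarrow> (\<forall>i<m. ?e x w i = 0)" for x w m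
    by (induction m) (auto simp: less_Suc_eq)
  show ?thesis
  proof (rule sigmaI)
    show "total_computable (\<lambda>z. rec_nat 0 (\<lambda>i r. r + ?e (pfst z) (psnd z) i) (n (pfst z)))"
      by (intro total_computable_intros total_computable_comp[OF d(1)] total_computable_nth_code
          total_computable_comp[OF assms(2)])
  next
    fix x
    have "(\<forall>i < n x. P x i) \<longleftrightarrow> (\<exists>w. \<forall>i < n x. ?e x w i = 0)"
    proof
      assume "\<forall>i < n x. P x i"
      then obtain h where h: "\<And>i. i < n x \<Longrightarrow> d (prod_encode (prod_encode (x, i), h i)) = 0"
        unfolding P by metis
      have "\<forall>i < n x. ?e x (list_encode (map h [0..<n x])) i = 0"
        using h by (simp add: nth_code_list_encode)
      then show "\<exists>w. \<forall>i < n x. ?e x w i = 0" ..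
    qed (auto simp: P)
    then show "(\<forall>i < n x. P x i) \<longleftrightarrow> (\<exists>w. rec_nat 0
        (\<lambda>i r. r + ?e (pfst (prod_encode (x, w))) (psnd (prod_encode (x, w))) i)
        (n (pfst (prod_encode (x, w)))) = 0)"
      by (simp add: sum)
  qed
qed

text \<open>The bounded quantifier runs up to the code rather than the length; positions past the
  end are recognised by an empty remainder and pass vacuously.\<close>

lemma sigma_ball_list_decode:
  assumes P: "sigma (\<lambda>z. P (pfst z) (psnd z))" and f: "total_computable f"
  shows "sigma (\<lambda>x. \<forall>y\<in>set (list_decode (f x)). P x y)"
proof -
  have eq: "(\<forall>y\<in>set (list_decode (f x)). P x y) \<longleftrightarrow>
      (\<forall>i < f x. drop_code (f x) i = 0 \<or> P x (nth_code (f x) i))" for x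
  proof -
    obtain ys where ys: "f x = list_encode ys" by (metis list_decode_inverse)
    have "drop_code (f x) i = 0 \<longleftrightarrow> length ys \<le> i" for i
      unfolding ys drop_code_list_encode
      by (metis drop_eq_Nil list_encode.simps(1) list_encode_inverse)
    moreover have "i < f x" if "i < length ys" for i
      using that length_le_list_encode[of ys] ys by simp
    moreover have "nth_code (f x) i = ys ! i" if "i < length ys" for i
      using that ys nth_code_list_encode by simp
    moreover have "(\<forall>y\<in>set (list_decode (f x)). P x y) \<longleftrightarrow> (\<forall>i < length ys. P x (ys ! i))"
      by (simp add: ys all_set_conv_all_nth)
    ultimately show ?thesis by (metis not_le)
  qed
  have "sigma (\<lambda>z. P (pfst z) (nth_code (f (pfst z)) (psnd z)))"
    using sigma_subst[OF P, of "\<lambda>z. prod_encode (pfst z, nth_code (f (pfst z)) (psnd z))"]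
    by (simp add: total_computable_intros total_computable_nth_code total_computable_comp[OF f])
  then show ?thesis
    unfolding eq
    by (intro sigma_all_less sigma_disj sigma_eq total_computable_intros total_computable_drop_code
        total_computable_comp[OF f] f)
qed

lemma sigma_mem_list_decode:
  assumes f: "total_computable f" and g: "total_computable g"
  shows "sigma (\<lambda>x. f x \<in> set (list_decode (g x)))"
proof -
  have eq: "f x \<in> set (list_decode (g x)) \<longleftrightarrow>
      (\<exists>i k. drop_code (g x) i = Suc (prod_encode (f x, k)))" for x
  proof -
    obtain ys where ys: "g x = list_encode ys" by (metis list_decode_inverse)
    show ?thesis
    proof
      assume "f x \<in> set (list_decode (g x))"
      then obtain i where "i < length ys" "ys ! i = f x" by (auto simp: ys in_set_conv_nth)
      then have "drop i ys = f x # drop (Suc i) ys" by (metis Cons_nth_drop_Suc)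
      then show "\<exists>i k. drop_code (g x) i = Suc (prod_encode (f x, k))"
        unfolding ys drop_code_list_encode by (metis list_encode.simps(2))
    next
      assume "\<exists>i k. drop_code (g x) i = Suc (prod_encode (f x, k))"
      then obtain i k where "list_encode (drop i ys) = Suc (prod_encode (f x, k))"
        unfolding ys drop_code_list_encode by blast
      then have "drop i ys = f x # list_decode k"
        by (metis list_decode_inverse list_encode.simps(2) list_encode_inverse)
      then have "f x \<in> set ys" by (metis in_set_dropD list.set_intros(1))
      then show "f x \<in> set (list_decode (g x))" by (simp add: ys)
    qed
  qed
  show ?thesis
    unfolding eq
    by (intro sigma_ex sigma_eq total_computable_intros total_computable_drop_code
        total_computable_comp[OF f] total_computable_comp[OF g])
qed

section \<open>Semidecidable predicates on coded types\<close>

text \<open>Semidecidability of the range is what allows an existential quantifier over the type to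
  be replaced by one over numbers, since a guessed number need not be a code.\<close>

class coded =
  fixes enc :: "'a \<Rightarrow> nat"
  assumes inj_enc: "inj enc"
    and sigma_range_enc: "sigma (\<lambda>n. n \<in> range enc)"

lemma enc_eq_iff [simp]: "enc x = enc y \<longleftrightarrow> x = y"
  using inj_enc by (auto dest: injD)

instantiation nat :: coded
begin
definition enc_nat :: "nat \<Rightarrow> nat" where [simp]: "enc_nat n = n"
instance
proof
  have "sigma (\<lambda>n. n = n)" by (rule sigma_eq) (rule total_computable_id)+
  moreover have "range (enc :: nat \<Rightarrow> nat) = UNIV" by (auto simp: image_def)
  ultimately show "sigma (\<lambda>n. n \<in> range (enc :: nat \<Rightarrow> nat))" by simp
qed (auto intro: injI)
end

instantiation prod :: (coded, coded) coded
begin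
definition enc_prod :: "'a \<times> 'b \<Rightarrow> nat" where
  "enc_prod p = prod_encode (enc (fst p), enc (snd p))"
instance
proof
  show "inj (enc :: 'a \<times> 'b \<Rightarrow> nat)"
    by (rule injI) (auto simp: enc_prod_def prod_eq_iff)
  have "n \<in> range (enc :: 'a \<times> 'b \<Rightarrow> nat) \<longleftrightarrow>
      pfst n \<in> range (enc :: 'a \<Rightarrow> nat) \<and> psnd n \<in> range (enc :: 'b \<Rightarrow> nat)" for n
  proof
    assume "pfst n \<in> range (enc :: 'a \<Rightarrow> nat) \<and> psnd n \<in> range (enc :: 'b \<Rightarrow> nat)"
    then obtain a :: 'a and b :: 'b where "pfst n = enc a" "psnd n = enc b" by auto
    then have "n = enc (a, b)"
      unfolding enc_prod_def by (metis fst_conv prod.collapse prod_decode_inverse snd_conv)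
    then show "n \<in> range (enc :: 'a \<times> 'b \<Rightarrow> nat)" by simp
  qed (auto simp: enc_prod_def)
  then show "sigma (\<lambda>n. n \<in> range (enc :: 'a \<times> 'b \<Rightarrow> nat))"
    by (simp add: sigma_conj sigma_subst[OF sigma_range_enc] total_computable_intros)
qed
end

lemma enc_Pair [simp]: "enc (a, b) = prod_encode (enc a, enc b)"
  by (simp add: enc_prod_def)

instantiation list :: (coded) coded
begin
definition enc_list :: "'a list \<Rightarrow> nat" where
  "enc_list xs = list_encode (map enc xs)"
instance
proof
  show "inj (enc :: 'a list \<Rightarrow> nat)"
    by (rule injI) (auto simp: enc_list_def inj_map_eq_map[OF inj_enc] dest: injD[OF inj_list_encode])
  have "n \<in> range (enc :: 'a list \<Rightarrow> nat) \<longleftrightarrow>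
      (\<forall>m\<in>set (list_decode n). m \<in> range (enc :: 'a \<Rightarrow> nat))" for n
  proof
    assume "\<forall>m\<in>set (list_decode n). m \<in> range (enc :: 'a \<Rightarrow> nat)"
    then have "list_decode n \<in> lists (range (enc :: 'a \<Rightarrow> nat))" by blast
    then obtain xs :: "'a list" where "list_decode n = map enc xs"
      by (auto simp: lists_image)
    then have "n = enc xs" unfolding enc_list_def by (metis list_decode_inverse)
    then show "n \<in> range (enc :: 'a list \<Rightarrow> nat)" by simp
  qed (auto simp: enc_list_def)
  then show "sigma (\<lambda>n. n \<in> range (enc :: 'a list \<Rightarrow> nat))"
    by (simp add: sigma_ball_list_decode sigma_subst[OF sigma_range_enc] total_computable_intros)
qed
end

lemma enc_Nil [simp]: "enc [] = 0"
  by (simp add: enc_list_def)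

lemma enc_Cons [simp]: "enc (x # xs) = Suc (prod_encode (enc x, enc xs))"
  by (simp add: enc_list_def)

text \<open>\<open>Q\<close> is unconstrained on numbers that code nothing. Passing to a set of
  codes or to an existential quantifier therefore adds membership in the range of
  \<open>enc\<close>.\<close>

definition RE :: "('a::coded \<Rightarrow> bool) \<Rightarrow> bool" where
  "RE P \<longleftrightarrow> (\<exists>Q. sigma Q \<and> (\<forall>a. P a \<longleftrightarrow> Q (enc a)))"

lemma REI: "sigma Q \<Longrightarrow> (\<And>a. P a \<longleftrightarrow> Q (enc a)) \<Longrightarrow> RE P"
  unfolding RE_def by blast

lemma REE:
  assumes "RE P"
  obtains Q where "sigma Q" "\<And>a. P a \<longleftrightarrow> Q (enc a)"
  using assms unfolding RE_def by blast

lemma RE_imp_Sigma01: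
  fixes P :: "'a::coded \<Rightarrow> bool"
  assumes "RE P"
  shows "{enc a | a. P a} \<in> Sigma01"
proof -
  obtain Q where Q: "sigma Q" "\<And>a. P a \<longleftrightarrow> Q (enc a)" using assms by (rule REE) blast
  have "{enc a | a. P a} = {n. n \<in> range (enc :: 'a \<Rightarrow> nat) \<and> Q n}"
    using Q(2) by auto
  moreover have "{n. n \<in> range (enc :: 'a \<Rightarrow> nat) \<and> Q n} \<in> Sigma01"
    by (intro Collect_sigma_in_Sigma01 sigma_conj sigma_range_enc Q(1))
  ultimately show ?thesis by metis
qed

lemma RE_conj:
  assumes "RE P" "RE Q" shows "RE (\<lambda>x. P x \<and> Q x)"
proof -
  obtain P' Q' where "sigma P'" "sigma Q'" "\<And>a. P a \<longleftrightarrow> P' (enc a)" "\<And>a. Q a \<longleftrightarrow> Q' (enc a)"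
    using assms unfolding RE_def by blast
  then show ?thesis by (intro REI[OF sigma_conj[of P' Q']]) simp_all
qed

lemma RE_disj:
  assumes "RE P" "RE Q" shows "RE (\<lambda>x. P x \<or> Q x)"
proof -
  obtain P' Q' where "sigma P'" "sigma Q'" "\<And>a. P a \<longleftrightarrow> P' (enc a)" "\<And>a. Q a \<longleftrightarrow> Q' (enc a)"
    using assms unfolding RE_def by blast
  then show ?thesis by (intro REI[OF sigma_disj[of P' Q']]) simp_all
qed

lemma RE_ex:
  fixes P :: "'a::coded \<Rightarrow> 'b::coded \<Rightarrow> bool"
  assumes "RE (\<lambda>z. P (fst z) (snd z))"
  shows "RE (\<lambda>x. \<exists>y. P x y)"
proof -
  obtain Q where Q: "sigma Q" "\<And>z. P (fst z) (snd z) \<longleftrightarrow> Q (enc z)" using assms by (rule REE) blast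
  have PQ: "P x y \<longleftrightarrow> Q (prod_encode (enc x, enc y))" for x y
    using Q(2)[of "(x, y)"] by simp
  show ?thesis
  proof (rule REI)
    show "sigma (\<lambda>n. \<exists>m. m \<in> range (enc :: 'b \<Rightarrow> nat) \<and> Q (prod_encode (n, m)))"
      by (intro sigma_ex sigma_conj sigma_subst[OF sigma_range_enc] sigma_subst[OF Q(1)]
          total_computable_intros)
  qed (auto simp: PQ)
qed

text \<open>The bridge from programs to types: \<open>g\<close> realises \<open>f\<close> on
  codes.\<close>

lemma RE_tracked:
  assumes "RE P" "total_computable g" "\<And>a. enc (f a) = g (enc a)"
  shows "RE (\<lambda>x. P (f x))"
proof -
  obtain Q where Q: "sigma Q" "\<And>a. P a \<longleftrightarrow> Q (enc a)" using assms(1) by (rule REE) blast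
  show ?thesis
    by (rule REI[OF sigma_subst[OF Q(1) assms(2)]]) (simp add: Q(2) assms(3))
qed

lemma RE_fst_eq_snd: "RE (\<lambda>z. fst z = snd z)"
  by (rule REI[OF sigma_eq[of pfst psnd]]) (intro total_computable_intros | simp add: enc_prod_def)+

lemma RE_fst_neq_snd: "RE (\<lambda>z. fst z \<noteq> snd z)"
  by (rule REI[OF sigma_neq[of pfst psnd]]) (intro total_computable_intros | simp add: enc_prod_def)+

text \<open>Defining computability by a semidecidable graph makes every total function given by a
  recursion equation computable as soon as its graph is an inductive predicate.\<close>

definition cmp :: "('a::coded \<Rightarrow> 'b::coded) \<Rightarrow> bool" where
  "cmp f \<longleftrightarrow> RE (\<lambda>z. f (fst z) = snd z)"

lemma cmp_tracked:
  assumes "total_computable g" "\<And>a. enc (f a) = g (enc a)"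
  shows "cmp f"
proof -
  have "total_computable (\<lambda>n. prod_encode (g (pfst n), psnd n))"
    by (intro total_computable_intros total_computable_comp[OF assms(1)])
  from RE_tracked[OF RE_fst_eq_snd this, of "\<lambda>z. (f (fst z), snd z)"] show ?thesis
    by (simp add: cmp_def assms(2) enc_prod_def)
qed

text \<open>A semidecidable graph suffices for substitution, because \<open>P (f x)\<close> says
  that some \<open>y\<close> satisfies both \<open>f x = y\<close> and \<open>P y\<close>.\<close>

lemma RE_subst:
  assumes "RE P" "cmp f"
  shows "RE (\<lambda>x. P (f x))"
proof -
  have "RE (\<lambda>z :: 'b \<times> 'a. P (snd z))"
    by (rule RE_tracked[OF assms(1), of psnd]) (intro total_computable_intros | simp add: enc_prod_def)+
  from RE_ex[OF RE_conj[OF assms(2)[unfolded cmp_def] this]] show ?thesis by simp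
qed

lemma cmp_id: "cmp (\<lambda>x. x)"
  by (rule cmp_tracked[OF total_computable_id]) simp

lemma cmp_const: "cmp (\<lambda>_. c)"
  by (rule cmp_tracked[OF total_computable_const[of "enc c"]]) simp

lemma cmp_pair:
  fixes f :: "'a::coded \<Rightarrow> 'b::coded" and g :: "'a \<Rightarrow> 'c::coded"
  assumes "cmp f" "cmp g"
  shows "cmp (\<lambda>x. (f x, g x))"
proof -
  have "RE (\<lambda>z :: 'a \<times> 'b \<times> 'c. f (fst z) = fst (snd z))"
    using RE_tracked[OF assms(1)[unfolded cmp_def], of "\<lambda>n. prod_encode (pfst n, pfst (psnd n))"
        "\<lambda>z :: 'a \<times> 'b \<times> 'c. (fst z, fst (snd z))"]
    by (simp add: enc_prod_def total_computable_intros)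
  moreover have "RE (\<lambda>z :: 'a \<times> 'b \<times> 'c. g (fst z) = snd (snd z))"
    using RE_tracked[OF assms(2)[unfolded cmp_def], of "\<lambda>n. prod_encode (pfst n, psnd (psnd n))"
        "\<lambda>z :: 'a \<times> 'b \<times> 'c. (fst z, snd (snd z))"]
    by (simp add: enc_prod_def total_computable_intros)
  ultimately show ?thesis
    unfolding cmp_def by (auto simp: prod_eq_iff dest: RE_conj)
qed

lemma cmp_comp:
  fixes f :: "'b::coded \<Rightarrow> 'c::coded" and g :: "'a::coded \<Rightarrow> 'b"
  assumes "cmp f" "cmp g"
  shows "cmp (\<lambda>x. f (g x))"
proof -
  have "cmp (\<lambda>z :: 'a \<times> 'c. g (fst z))"
    unfolding cmp_def
    using RE_tracked[OF assms(2)[unfolded cmp_def], of "\<lambda>n. prod_encode (pfst (pfst n), psnd n)"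
        "\<lambda>z :: ('a \<times> 'c) \<times> 'b. (fst (fst z), snd z)"]
    by (simp add: enc_prod_def total_computable_intros)
  moreover have "cmp (snd :: 'a \<times> 'c \<Rightarrow> 'c)"
    by (rule cmp_tracked[of psnd]) (intro total_computable_intros | simp add: enc_prod_def)+
  ultimately have "cmp (\<lambda>z :: 'a \<times> 'c. (g (fst z), snd z))" by (rule cmp_pair)
  from RE_subst[OF assms(1)[unfolded cmp_def] this] show ?thesis by (simp add: cmp_def)
qed

lemma cmp_comp2:
  assumes "cmp (\<lambda>z. f (fst z) (snd z))" "cmp g" "cmp h"
  shows "cmp (\<lambda>x. f (g x) (h x))"
  using cmp_comp[OF assms(1) cmp_pair[OF assms(2,3)]] by simp

lemma cmp_fst: "cmp f \<Longrightarrow> cmp (\<lambda>x. fst (f x))"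
  by (rule cmp_comp[of fst], rule cmp_tracked[of pfst]) (intro total_computable_intros | simp add: enc_prod_def)+

lemma cmp_snd: "cmp f \<Longrightarrow> cmp (\<lambda>x. snd (f x))"
  by (rule cmp_comp[of snd], rule cmp_tracked[of psnd]) (intro total_computable_intros | simp add: enc_prod_def)+

lemma cmp_Suc: "cmp f \<Longrightarrow> cmp (\<lambda>x. Suc (f x))"
  by (rule cmp_comp[of Suc], rule cmp_tracked[of Suc]) (intro total_computable_intros | simp)+

lemma cmp_add: "cmp f \<Longrightarrow> cmp g \<Longrightarrow> cmp (\<lambda>x. f x + g x :: nat)"
  by (rule cmp_comp2[of "(+)"], rule cmp_tracked[of "\<lambda>n. pfst n + psnd n"])
    (intro total_computable_intros | simp add: enc_prod_def)+

lemma cmp_Cons: "cmp f \<Longrightarrow> cmp g \<Longrightarrow> cmp (\<lambda>x. f x # g x)"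
  by (rule cmp_comp2[of "(#)"], rule cmp_tracked[of Suc])
    (intro total_computable_intros | simp add: enc_prod_def)+

lemmas cmp_intros = cmp_id cmp_const cmp_pair cmp_fst cmp_snd cmp_Suc cmp_add cmp_Cons

lemma RE_eq: "cmp f \<Longrightarrow> cmp g \<Longrightarrow> RE (\<lambda>x. f x = g x)"
  using RE_subst[OF RE_fst_eq_snd cmp_pair[of f g]] by simp

lemma RE_neq: "cmp f \<Longrightarrow> cmp g \<Longrightarrow> RE (\<lambda>x. f x \<noteq> g x)"
  using RE_subst[OF RE_fst_neq_snd cmp_pair[of f g]] by simp

lemma RE_mem:
  assumes "cmp f" "cmp g"
  shows "RE (\<lambda>x. f x \<in> set (g x))"
proof -
  have "RE (\<lambda>z :: 'b \<times> 'b list. fst z \<in> set (snd z))"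
  proof (rule REI)
    show "sigma (\<lambda>n. pfst n \<in> set (list_decode (psnd n)))"
      by (intro sigma_mem_list_decode total_computable_intros)
  qed (simp add: enc_prod_def enc_list_def inj_image_mem_iff[OF inj_enc])
  from RE_subst[OF this cmp_pair[OF assms]] show ?thesis by simp
qed

lemma RE_ball:
  fixes P :: "'a::coded \<Rightarrow> 'b::coded \<Rightarrow> bool"
  assumes "RE (\<lambda>z. P (fst z) (snd z))" "cmp f"
  shows "RE (\<lambda>x. \<forall>y\<in>set (f x). P x y)"
proof -
  obtain Q where Q: "sigma Q" "\<And>z. P (fst z) (snd z) \<longleftrightarrow> Q (enc z)" using assms(1) by (rule REE) blast
  have PQ: "P x y \<longleftrightarrow> Q (prod_encode (enc x, enc y))" for x y
    using Q(2)[of "(x, y)"] by simp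
  have "RE (\<lambda>z. \<forall>y\<in>set (snd z). P (fst z) y)"
  proof (rule REI)
    show "sigma (\<lambda>n. \<forall>y\<in>set (list_decode (psnd n)). Q (prod_encode (pfst n, y)))"
      by (intro sigma_ball_list_decode sigma_subst[OF Q(1)] total_computable_intros)
  qed (auto simp: PQ enc_prod_def enc_list_def)
  from RE_subst[OF this cmp_pair[OF cmp_id assms(2)]] show ?thesis by simp
qed

lemma RE_bex:
  assumes "RE (\<lambda>z. P (fst z) (snd z))" "cmp f"
  shows "RE (\<lambda>x. \<exists>y\<in>set (f x). P x y)"
proof -
  have "RE (\<lambda>x. \<exists>y. y \<in> set (f x) \<and> P x y)"
    by (intro RE_ex RE_conj RE_mem cmp_comp[OF assms(2)] cmp_intros assms(1))
  then show ?thesis by (simp add: Bex_def)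
qed

lemmas RE_intros = RE_conj RE_disj RE_ball RE_bex RE_ex RE_mem RE_eq RE_neq

text \<open>The graph is a disjunction of the two branches. This needs both the equality and the
  inequality of the compared values to be semidecidable.\<close>

lemma cmp_if_eq:
  assumes "cmp f" "cmp g" "cmp a" "cmp b"
  shows "cmp (\<lambda>x. if f x = g x then a x else b x)"
proof -
  have "RE (\<lambda>z. (f (fst z) = g (fst z) \<and> a (fst z) = snd z) \<or> (f (fst z) \<noteq> g (fst z) \<and> b (fst z) = snd z))"
    by (intro RE_intros cmp_comp[OF assms(1)] cmp_comp[OF assms(2)] cmp_comp[OF assms(3)]
        cmp_comp[OF assms(4)] cmp_intros)
  then show ?thesis unfolding cmp_def by (rule back_subst[of RE]) (auto simp: fun_eq_iff)
qed

section \<open>Inductive predicates through finite derivations\<close>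

inductive Der :: "('a \<Rightarrow> 'a list \<Rightarrow> bool) \<Rightarrow> 'a \<Rightarrow> bool" for Step where
  DerI: "Step x ps \<Longrightarrow> (\<And>p. p \<in> set ps \<Longrightarrow> Der Step p) \<Longrightarrow> Der Step x"

text \<open>A proof tree for \<open>Der\<close>, flattened to a list with the latest conclusion in
  front. As premises come in finite lists, the whole proof becomes a finite object that has a
  code.\<close>

inductive derivation :: "('a \<Rightarrow> 'a list \<Rightarrow> bool) \<Rightarrow> 'a list \<Rightarrow> bool" for Step where
  derivation_Nil: "derivation Step []"
| derivation_Cons: "derivation Step N \<Longrightarrow> Step x ps \<Longrightarrow> set ps \<subseteq> set N \<Longrightarrow> derivation Step (x # N)"

lemma derivation_append: "derivation Step L \<Longrightarrow> derivation Step M \<Longrightarrow> derivation Step (L @ M)"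
proof (induction rule: derivation.induct)
  case (derivation_Cons N x ps)
  then show ?case using derivation.derivation_Cons[of Step "N @ M" x ps] by auto
qed simp

lemma derivation_Der: "derivation Step L \<Longrightarrow> x \<in> set L \<Longrightarrow> Der Step x"
proof (induction arbitrary: x rule: derivation.induct)
  case (derivation_Cons N y ps)
  then show ?case using DerI[of Step y ps] by auto
qed simp

lemma Der_derivation: "Der Step x \<Longrightarrow> \<exists>L. derivation Step L \<and> x \<in> set L"
proof (induction rule: Der.induct)
  case (DerI x ps)
  have "\<exists>L. derivation Step L \<and> set qs \<subseteq> set L" if "set qs \<subseteq> set ps" for qs
    using that
  proof (induction qs)
    case Nil
    then show ?case using derivation_Nil by force
  next
    case (Cons q qs)
    then obtain L where "derivation Step L" "set qs \<subseteq> set L" by auto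
    moreover obtain M where "derivation Step M" "q \<in> set M" using DerI.IH Cons.prems by auto
    ultimately show ?case by (intro exI[of _ "M @ L"]) (auto intro: derivation_append)
  qed
  then obtain L where "derivation Step L" "set ps \<subseteq> set L" by auto
  then show ?case using DerI.hyps(1) derivation_Cons[of Step L x ps] by (intro exI[of _ "x # L"]) simp
qed

text \<open>The certificate for a derivation lists all its suffixes, which turns the condition on
  each step into a quantification over list members.\<close>

lemma derivation_iff_suffixes:
  "derivation Step L \<longleftrightarrow> (\<exists>C. L \<in> set C \<and> (\<forall>M\<in>set C. M = [] \<or>
     (\<exists>x N ps. M = x # N \<and> N \<in> set C \<and> Step x ps \<and> (\<forall>p\<in>set ps. p \<in> set N))))"
    (is "_ \<longleftrightarrow> (\<exists>C. L \<in> set C \<and> ?cert C)")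
proof
  assume "derivation Step L"
  then show "\<exists>C. L \<in> set C \<and> ?cert C"
  proof (induction rule: derivation.induct)
    case derivation_Nil
    then show ?case by (intro exI[of _ "[[]]"]) auto
  next
    case (derivation_Cons N x ps)
    then obtain C where C: "N \<in> set C" "?cert C" by auto
    have "?cert ((x # N) # C)"
    proof
      fix M assume "M \<in> set ((x # N) # C)"
      then show "M = [] \<or> (\<exists>y N' ps. M = y # N' \<and> N' \<in> set ((x # N) # C) \<and> Step y ps \<and>
          (\<forall>p\<in>set ps. p \<in> set N'))"
        using C derivation_Cons.hyps by (cases "M = x # N") (auto, blast+)
    qed
    then show ?case by (intro exI[of _ "(x # N) # C"]) auto
  qed
next
  assume "\<exists>C. L \<in> set C \<and> ?cert C"
  then obtain C where C: "L \<in> set C" "?cert C" by blast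
  have "M \<in> set C \<Longrightarrow> derivation Step M" for M
  proof (induction M)
    case Nil
    then show ?case by (simp add: derivation_Nil)
  next
    case (Cons x N)
    then obtain ps where "N \<in> set C" "Step x ps" "\<forall>p\<in>set ps. p \<in> set N" using C(2) by blast
    then show ?case using Cons.IH derivation_Cons[of Step N x ps] by blast
  qed
  then show "derivation Step L" using C(1) .
qed

lemma RE_Der:
  assumes "RE (\<lambda>z. Step (fst z) (snd z))"
  shows "RE (Der Step)"
proof -
  have S: "RE (\<lambda>x. Step (f x) (g x))" if "cmp f" "cmp g" for f :: "'b::coded \<Rightarrow> 'a" and g
    using RE_subst[OF assms cmp_pair[OF that]] by simp
  have "RE (\<lambda>x. \<exists>L. x \<in> set L \<and> derivation Step L)"
    unfolding derivation_iff_suffixes by (intro RE_intros S cmp_intros)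
  moreover have "Der Step = (\<lambda>x. \<exists>L. x \<in> set L \<and> derivation Step L)"
    using Der_derivation[of Step] derivation_Der[of Step] by (intro ext) blast
  ultimately show ?thesis by simp
qed

section \<open>Computable recursion\<close>

text \<open>The triples of parameter, list and value form an inductive predicate in which the triple
  for the tail is the premise. Induction on derivations shows that only correct values are derived,
  induction on the list that all of them are, so the predicate is the graph of
  \<open>F\<close>.\<close>

lemma cmp_rec_list:
  fixes F :: "'e::coded \<Rightarrow> 'a::coded list \<Rightarrow> 'b::coded"
  assumes F_Nil: "\<And>e. F e [] = a e" and F_Cons: "\<And>e x xs. F e (x # xs) = b e x xs (F e xs)"
    and a: "cmp a"
    and b: "cmp (\<lambda>z. b (fst z) (fst (snd z)) (fst (snd (snd z))) (snd (snd (snd z))))"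
    and f: "cmp f" and g: "cmp g"
  shows "cmp (\<lambda>x. F (f x) (g x))"
proof -
  define Step :: "'e \<times> 'a list \<times> 'b \<Rightarrow> ('e \<times> 'a list \<times> 'b) list \<Rightarrow> bool" where
    "Step q ps \<longleftrightarrow> (fst (snd q) = [] \<and> snd (snd q) = a (fst q)) \<or>
      (\<exists>x xs r. fst (snd q) = x # xs \<and> (fst q, xs, r) \<in> set ps \<and> snd (snd q) = b (fst q) x xs r)" for q ps
  have b': "cmp (\<lambda>x. b (f1 x) (f2 x) (f3 x) (f4 x))" if "cmp f1" "cmp f2" "cmp f3" "cmp f4"
    for f1 :: "'z::coded \<Rightarrow> 'e" and f2 f3 f4
    using cmp_comp[OF b, of "\<lambda>x. (f1 x, f2 x, f3 x, f4 x)"] that by (simp add: cmp_pair)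
  have RS: "RE (\<lambda>z. Step (fst z) (snd z))"
    unfolding Step_def by (intro RE_intros cmp_comp[OF a] b' cmp_intros)
  have "Der Step q \<Longrightarrow> F (fst q) (fst (snd q)) = snd (snd q)" for q
  proof (induction rule: Der.induct)
    case (DerI q ps)
    then show ?case unfolding Step_def using F_Nil F_Cons by fastforce
  qed
  moreover have "Der Step (e, xs, F e xs)" for e xs
  proof (induction xs)
    case Nil
    show ?case by (rule DerI[of _ _ "[]"]) (auto simp: Step_def F_Nil)
  next
    case (Cons x xs)
    show ?case by (rule DerI[of _ _ "[(e, xs, F e xs)]"]) (use Cons in \<open>auto simp: Step_def F_Cons\<close>)
  qed
  ultimately have "F (f x) (g x) = y \<longleftrightarrow> Der Step (f x, g x, y)" for x y by fastforce
  moreover have "RE (\<lambda>z. Der Step (f (fst z), g (fst z), snd z))"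
    by (intro RE_subst[OF RE_Der[OF RS]] cmp_intros cmp_comp[OF f] cmp_comp[OF g])
  ultimately show ?thesis unfolding cmp_def by simp
qed

lemma cmp_append: "cmp f \<Longrightarrow> cmp g \<Longrightarrow> cmp (\<lambda>x. f x @ g x)"
  by (rule cmp_rec_list[where F = "\<lambda>e xs. xs @ e" and a = "\<lambda>e. e" and b = "\<lambda>_ x _ r. x # r"])
    (auto intro!: cmp_intros)

lemma cmp_concat: "cmp f \<Longrightarrow> cmp (\<lambda>x. concat (f x))"
  by (rule cmp_rec_list[where F = "\<lambda>_. concat" and a = "\<lambda>_. []" and b = "\<lambda>_ x _ r. x @ r" and f = "\<lambda>_. 0 :: nat"])
    (auto intro!: cmp_intros cmp_append)

lemma cmp_map:
  assumes "cmp (\<lambda>z. h (fst z) (snd z))" "cmp g"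
  shows "cmp (\<lambda>x. map (\<lambda>y. h x y) (g x))"
  by (rule cmp_rec_list[where F = "\<lambda>e. map (h e)" and a = "\<lambda>_. []" and b = "\<lambda>e x _ r. h e x # r"])
    (auto intro!: cmp_intros cmp_comp2[OF assms(1)] assms(2))

section \<open>Coded terms\<close>

lemma inj_enc_term: "enc_term s = enc_term t \<Longrightarrow> s = t"
proof (induction s arbitrary: t)
  case (Var x)
  then show ?case by (cases t) simp_all
next
  case (Fun f ss)
  then obtain ts where t: "t = Fun f ts" "map enc_term ss = map enc_term ts"
    by (cases t) (auto dest: injD[OF inj_list_encode])
  then have "ss = ts" using Fun.IH
    by (auto simp: list_eq_iff_nth_eq)
  then show ?case using t by simp
qed

lemma cmp_prod_encode: "cmp f \<Longrightarrow> cmp g \<Longrightarrow> cmp (\<lambda>x. prod_encode (f x, g x))"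
  by (rule cmp_comp2[of "\<lambda>a b. prod_encode (a, b)"], rule cmp_tracked[of "\<lambda>n. n"])
    (intro total_computable_intros | simp add: enc_prod_def)+

instantiation trm :: coded
begin
definition enc_trm :: "trm \<Rightarrow> nat" where "enc_trm = enc_term"
instance
proof
  show "inj (enc :: trm \<Rightarrow> nat)" by (rule injI) (simp add: enc_trm_def inj_enc_term)
  \<comment> \<open>The codes of terms are generated inductively, with the codes of the arguments as
    premises; derivations over plain numbers therefore settle the range axiom.\<close>
  define Step :: "nat \<Rightarrow> nat list \<Rightarrow> bool" where
    "Step n ps \<longleftrightarrow> (\<exists>x. n = prod_encode (0, x)) \<or>
      (\<exists>f. n = prod_encode (1, prod_encode (f, list_encode ps)))" for n ps
  \<comment> \<open>On lists of numbers \<open>enc\<close> and \<open>list_encode\<close> agree, so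
    the identity on codes realises this function.\<close>
  have e: "cmp list_encode"
    by (rule cmp_tracked[OF total_computable_id]) (simp add: enc_list_def map_idI)
  have "RE (\<lambda>z. Step (fst z) (snd z))"
    unfolding Step_def
    by (intro RE_intros cmp_prod_encode cmp_comp[OF e] cmp_intros)
  then have "RE (Der Step)" by (rule RE_Der)
  then obtain Q where Q: "sigma Q" "\<And>n. Der Step n \<longleftrightarrow> Q (enc n)" by (rule REE) blast
  have "Der Step n \<longleftrightarrow> n \<in> range (enc :: trm \<Rightarrow> nat)" for n
  proof
    assume "Der Step n"
    then show "n \<in> range (enc :: trm \<Rightarrow> nat)"
    proof (induction rule: Der.induct)
      case (DerI n ps)
      then have "ps \<in> lists (range enc_term)" by (auto simp: enc_trm_def)
      then obtain ts where "ps = map enc_term ts" by (auto simp: lists_image)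
      then have "(\<exists>x. n = enc_term (Var x)) \<or> (\<exists>f. n = enc_term (Fun f ts))"
        using DerI.hyps(1) by (auto simp: Step_def)
      then show ?case unfolding enc_trm_def by blast
    qed
  next
    have "Der Step (enc_term t)" for t
    proof (induction t)
      case (Var x)
      show ?case by (rule DerI[of _ _ "[]"]) (auto simp: Step_def)
    next
      case (Fun f ts)
      show ?case
        by (rule DerI[of _ _ "map enc_term ts"])
          (use Fun in \<open>auto simp: Step_def\<close>)
    qed
    then show "Der Step n" if "n \<in> range (enc :: trm \<Rightarrow> nat)" using that by (auto simp: enc_trm_def)
  qed
  then have "(\<lambda>n. n \<in> range (enc :: trm \<Rightarrow> nat)) = Q" using Q(2) by (auto simp: fun_eq_iff)
  then show "sigma (\<lambda>n. n \<in> range (enc :: trm \<Rightarrow> nat))" using Q(1) by simp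
qed
end

lemma enc_Var: "enc (Var x) = prod_encode (0, x)"
  by (simp add: enc_trm_def)

lemma enc_Fun: "enc (Fun f ts) = prod_encode (1, prod_encode (f, enc ts))"
  by (simp add: enc_trm_def enc_list_def)

text \<open>Identifies the prescribed numbering of rewrite systems with the one from the type class,
  to which all closure properties refer.\<close>

lemma enc_trs_eq_enc: "enc_trs rs = enc rs"
  unfolding enc_trs_def enc_list_def
  by (rule arg_cong[of _ _ list_encode]) (auto simp: enc_prod_def enc_trm_def)

lemma cmp_Var: "cmp f \<Longrightarrow> cmp (\<lambda>x. Var (f x))"
  by (rule cmp_comp[of Var], rule cmp_tracked[of "\<lambda>n. prod_encode (0, n)"])
    (intro total_computable_intros | simp add: enc_Var)+

lemma cmp_Fun: "cmp f \<Longrightarrow> cmp g \<Longrightarrow> cmp (\<lambda>x. Fun (f x) (g x))"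
  by (rule cmp_comp2[of Fun], rule cmp_tracked[of "\<lambda>n. prod_encode (1, n)"])
    (intro total_computable_intros | simp add: enc_Fun enc_prod_def)+

text \<open>The step function sees every argument together with its recursive value, since
  \<open>subterms\<close> and \<open>contexts\<close> have to rebuild the original term. In the
  derivation step the list of such pairs is guessed, and its first components are compared with the
  actual arguments.\<close>

lemma cmp_rec_trm:
  fixes F :: "'e::coded \<Rightarrow> trm \<Rightarrow> 'b::coded"
  assumes F_Var: "\<And>e x. F e (Var x) = a e x"
    and F_Fun: "\<And>e k ts. F e (Fun k ts) = b e k (map (\<lambda>t. (t, F e t)) ts)"
    and a: "cmp (\<lambda>z. a (fst z) (snd z))"
    and b: "cmp (\<lambda>z. b (fst z) (fst (snd z)) (snd (snd z)))"
    and f: "cmp f" and g: "cmp g"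
  shows "cmp (\<lambda>x. F (f x) (g x))"
proof -
  define Step :: "'e \<times> trm \<times> 'b \<Rightarrow> ('e \<times> trm \<times> 'b) list \<Rightarrow> bool" where
    "Step q ps \<longleftrightarrow> (\<exists>x. fst (snd q) = Var x \<and> snd (snd q) = a (fst q) x) \<or>
      (\<exists>k vs. fst (snd q) = Fun k (map (\<lambda>v. fst v) vs) \<and> snd (snd q) = b (fst q) k vs \<and>
        (\<forall>v\<in>set vs. (fst q, v) \<in> set ps))" for q ps
  have b': "cmp (\<lambda>x. b (f1 x) (f2 x) (f3 x))" if "cmp f1" "cmp f2" "cmp f3"
    for f1 :: "'z::coded \<Rightarrow> 'e" and f2 f3
    using cmp_comp[OF b, of "\<lambda>x. (f1 x, f2 x, f3 x)"] that by (simp add: cmp_pair)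
  have RS: "RE (\<lambda>z. Step (fst z) (snd z))"
    unfolding Step_def by (intro RE_intros cmp_comp2[OF a] b' cmp_Fun cmp_Var cmp_map cmp_intros)
  have "Der Step q \<Longrightarrow> F (fst q) (fst (snd q)) = snd (snd q)" for q
  proof (induction rule: Der.induct)
    case (DerI q ps)
    consider x where "fst (snd q) = Var x" "snd (snd q) = a (fst q) x"
      | k vs where "fst (snd q) = Fun k (map fst vs)" "snd (snd q) = b (fst q) k vs"
          "\<forall>v\<in>set vs. (fst q, v) \<in> set ps"
      using DerI.hyps(1) unfolding Step_def by auto
    then show ?case
    proof cases
      case 1
      then show ?thesis by (simp add: F_Var)
    next
      case 2
      have "map (\<lambda>v. (fst v, F (fst q) (fst v))) vs = vs"
        using DerI.IH 2(3) by (intro map_idI) fastforce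
      then show ?thesis using 2 by (simp add: F_Fun comp_def)
    qed
  qed
  moreover have "Der Step (e, t, F e t)" for e t
  proof (induction t)
    case (Var x)
    show ?case by (rule DerI[of _ _ "[]"]) (auto simp: Step_def F_Var)
  next
    case (Fun k ts)
    show ?case
      by (rule DerI[of _ _ "map (\<lambda>t. (e, t, F e t)) ts"])
        (use Fun in \<open>auto simp: Step_def F_Fun comp_def intro!: exI[of _ "map (\<lambda>t. (t, F e t)) ts"]\<close>)
  qed
  ultimately have "F (f x) (g x) = y \<longleftrightarrow> Der Step (f x, g x, y)" for x y by fastforce
  moreover have "RE (\<lambda>z. Der Step (f (fst z), g (fst z), snd z))"
    by (intro RE_subst[OF RE_Der[OF RS]] cmp_intros cmp_comp[OF f] cmp_comp[OF g])
  ultimately show ?thesis unfolding cmp_def by simp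
qed

section \<open>Local confluence and overlaps\<close>

definition joinable :: "trs \<Rightarrow> trm \<Rightarrow> trm \<Rightarrow> bool" where
  "joinable R s t \<longleftrightarrow> (\<exists>d. (rstep R)\<^sup>*\<^sup>* s d \<and> (rstep R)\<^sup>*\<^sup>* t d)"

lemma joinableI: "(rstep R)\<^sup>*\<^sup>* s d \<Longrightarrow> (rstep R)\<^sup>*\<^sup>* t d \<Longrightarrow> joinable R s t"
  unfolding joinable_def by blast

lemma joinable_sym: "joinable R s t \<Longrightarrow> joinable R t s"
  unfolding joinable_def by blast

lemma weakly_confluent_on_iff_joinable:
  "weakly_confluent_on R t \<longleftrightarrow> (\<forall>t1 t2. rstep R t t1 \<longrightarrow> rstep R t t2 \<longrightarrow> joinable R t1 t2)"
  unfolding weakly_confluent_on_def joinable_def by blast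

lemma subst_cong: "(\<And>x. x \<in> vars t \<Longrightarrow> \<sigma> x = \<tau> x) \<Longrightarrow> subst \<sigma> t = subst \<tau> t"
  by (induction t) auto

lemma subst_subst: "subst \<sigma> (subst \<tau> t) = subst (\<lambda>x. subst \<sigma> (\<tau> x)) t"
  by (induction t) auto

lemma subst_Var: "subst Var t = t"
  by (induction t) (auto simp: map_idI)

lemma vars_subst: "vars (subst \<sigma> t) = (\<Union>x\<in>vars t. vars (\<sigma> x))"
  by (induction t) auto

lemma rstep_subst: "rstep R s t \<Longrightarrow> rstep R (subst \<sigma> s) (subst \<sigma> t)"
proof (induction rule: rstep.induct)
  case (root l r \<tau>)
  then show ?case unfolding subst_subst by (rule rstep.root)
next
  case (ctxt s t f ss us)
  then show ?case using rstep.ctxt[of R "subst \<sigma> s" "subst \<sigma> t"] by simp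
qed

lemma rsteps_subst: "(rstep R)\<^sup>*\<^sup>* s t \<Longrightarrow> (rstep R)\<^sup>*\<^sup>* (subst \<sigma> s) (subst \<sigma> t)"
proof (induction rule: rtranclp_induct)
  case (step y z)
  then show ?case by (meson rstep_subst rtranclp.rtrancl_into_rtrancl)
qed simp

lemma joinable_subst: "joinable R s t \<Longrightarrow> joinable R (subst \<sigma> s) (subst \<sigma> t)"
  unfolding joinable_def by (blast intro: rsteps_subst)

lemma rsteps_ctxt:
  "(rstep R)\<^sup>*\<^sup>* s t \<Longrightarrow> (rstep R)\<^sup>*\<^sup>* (Fun f (ss @ s # us)) (Fun f (ss @ t # us))"
proof (induction rule: rtranclp_induct)
  case (step y z)
  then show ?case by (meson rstep.ctxt rtranclp.rtrancl_into_rtrancl)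
qed simp

lemma rsteps_args:
  "list_all2 (rstep R)\<^sup>*\<^sup>* ss ts \<Longrightarrow> (rstep R)\<^sup>*\<^sup>* (Fun f (us @ ss)) (Fun f (us @ ts))"
proof (induction ss ts arbitrary: us rule: list_all2_induct)
  case (Cons s ss t ts)
  have "(rstep R)\<^sup>*\<^sup>* (Fun f (us @ s # ss)) (Fun f (us @ t # ss))"
    using Cons.hyps(1) by (rule rsteps_ctxt)
  also have "(rstep R)\<^sup>*\<^sup>* (Fun f (us @ t # ss)) (Fun f (us @ t # ts))"
    using Cons.IH[of "us @ [t]"] by simp
  finally show ?case .
qed simp

lemma rsteps_subst_pointwise:
  assumes "\<And>x. (rstep R)\<^sup>*\<^sup>* (\<sigma> x) (\<tau> x)"
  shows "(rstep R)\<^sup>*\<^sup>* (subst \<sigma> t) (subst \<tau> t)"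
proof (induction t)
  case (Fun f ts)
  then show ?case
    using rsteps_args[of R "map (subst \<sigma>) ts" "map (subst \<tau>) ts" f "[]"]
    by (simp add: list_all2_conv_all_nth)
qed (simp add: assms)

text \<open>\<open>context_of n t u C\<close> says that \<open>t\<close> has the non-variable subterm \<open>u\<close> in the context \<open>C\<close>;
  the hole of the context is the variable \<open>n\<close>, to be chosen fresh for \<open>t\<close>.\<close>

inductive context_of :: "nat \<Rightarrow> trm \<Rightarrow> trm \<Rightarrow> trm \<Rightarrow> bool" for n where
  context_root: "context_of n (Fun f ts) (Fun f ts) (Var n)"
| context_arg: "context_of n t u C \<Longrightarrow> context_of n (Fun f (ss @ t # us)) u (Fun f (ss @ C # us))"

definition fill :: "nat \<Rightarrow> trm \<Rightarrow> trm \<Rightarrow> trm" where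
  "fill n u C = subst (\<lambda>x. if x = n then u else Var x) C"

lemma subst_fill: "subst \<sigma> (fill n u C) = subst (\<sigma>(n := subst \<sigma> u)) C"
  unfolding fill_def subst_subst by (rule subst_cong) simp

lemma map_subst_fun_upd_fresh:
  "(\<And>t. t \<in> set ts \<Longrightarrow> n \<notin> vars t) \<Longrightarrow> map (subst (\<sigma>(n := v))) ts = map (subst \<sigma>) ts"
  by (auto intro!: subst_cong)

lemma context_of_rstep:
  "context_of n t u C \<Longrightarrow> n \<notin> vars t \<Longrightarrow> rstep R (subst \<sigma> u) v \<Longrightarrow>
    rstep R (subst \<sigma> t) (subst (\<sigma>(n := v)) C)"
proof (induction rule: context_of.induct)
  case (context_arg t u C f ss us)
  then show ?case
    using rstep.ctxt[of R "subst \<sigma> t" "subst (\<sigma>(n := v)) C" f "map (subst \<sigma>) ss" "map (subst \<sigma>) us"]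
    by (simp add: map_subst_fun_upd_fresh del: fun_upd_apply)
qed simp

text \<open>The dichotomy behind the critical pair lemma: the redex is an instance of a non-variable
  subterm of \<open>l\<close>, or it lies inside the instance of a variable \<open>x\<close>. In the
  latter case only one copy of \<open>\<sigma> x\<close> has been rewritten, and the remaining
  copies are brought into line by further steps, whence the reflexive-transitive closure.\<close>

lemma rstep_subst_cases:
  assumes "rstep R (subst \<sigma> l) t" "n \<notin> vars l"
  shows "(\<exists>u C l' r' \<tau>. context_of n l u C \<and> (l', r') \<in> R \<and> subst \<sigma> u = subst \<tau> l' \<and>
            t = subst (\<sigma>(n := subst \<tau> r')) C) \<or>
         (\<exists>x v. rstep R (\<sigma> x) v \<and> (rstep R)\<^sup>*\<^sup>* t (subst (\<sigma>(x := v)) l))"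
  using assms
proof (induction l arbitrary: t)
  case (Var x)
  then show ?case by (intro disjI2 exI[of _ x] exI[of _ t]) simp
next
  case (Fun f ls)
  from Fun.prems(1) show ?case
  proof (cases rule: rstep.cases)
    case (root l' r' \<tau>)
    then show ?thesis
      by (intro disjI1 exI[of _ "Fun f ls"] exI[of _ "Var n"] exI[of _ l'] exI[of _ r'] exI[of _ \<tau>])
        (simp add: context_root)
  next
    case (ctxt s t' g ss us)
    then obtain ls1 l ls2 where ls: "ls = ls1 @ l # ls2" "ss = map (subst \<sigma>) ls1" "s = subst \<sigma> l"
      "us = map (subst \<sigma>) ls2" "g = f"
      by (auto simp: map_eq_append_conv map_eq_Cons_conv)
    have fresh: "n \<notin> vars l" "\<And>l. l \<in> set ls1 \<union> set ls2 \<Longrightarrow> n \<notin> vars l"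
      using Fun.prems(2) ls(1) by auto
    have "rstep R (subst \<sigma> l) t'" using ctxt(3) ls(3) by simp
    from Fun.IH[OF _ this fresh(1)] ls(1) consider
      u C l' r' \<tau> where "context_of n l u C" "(l', r') \<in> R" "subst \<sigma> u = subst \<tau> l'"
        "t' = subst (\<sigma>(n := subst \<tau> r')) C"
      | x v where "rstep R (\<sigma> x) v" "(rstep R)\<^sup>*\<^sup>* t' (subst (\<sigma>(x := v)) l)"
      by (metis in_set_conv_decomp)
    then show ?thesis
    proof cases
      case 1
      have "t = subst (\<sigma>(n := subst \<tau> r')) (Fun f (ls1 @ C # ls2))"
        using ctxt(2) ls 1(4) fresh(2) by (simp add: map_subst_fun_upd_fresh del: fun_upd_apply)
      moreover have "context_of n (Fun f ls) u (Fun f (ls1 @ C # ls2))"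
        unfolding ls(1) using 1(1) by (rule context_arg)
      ultimately show ?thesis using 1(2,3) by blast
    next
      case 2
      have *: "(rstep R)\<^sup>*\<^sup>* (subst \<sigma> a) (subst (\<sigma>(x := v)) a)" for a
        using 2(1) by (intro rsteps_subst_pointwise) auto
      have "(rstep R)\<^sup>*\<^sup>* (Fun f ([] @ (map (subst \<sigma>) ls1 @ t' # map (subst \<sigma>) ls2)))
          (Fun f ([] @ map (subst (\<sigma>(x := v))) ls))"
        unfolding ls(1) by (intro rsteps_args)
          (auto intro!: list_all2_appendI simp: list_all2_map1 list_all2_map2 list_all2_same * 2(2))
      then have "(rstep R)\<^sup>*\<^sup>* t (subst (\<sigma>(x := v)) (Fun f ls))"
        using ctxt(2) ls by (simp del: fun_upd_apply)
      then show ?thesis using 2(1) by blast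
    qed
  qed
qed

text \<open>The variables of the two rules of an overlap are renamed apart to even and odd numbers;
  the variable \<open>0\<close> remains free for the hole of the context.\<close>

abbreviation ren_even :: "trm \<Rightarrow> trm" where "ren_even \<equiv> subst (\<lambda>x. Var (Suc (Suc (x + x))))"
abbreviation ren_odd :: "trm \<Rightarrow> trm" where "ren_odd \<equiv> subst (\<lambda>x. Var (Suc (x + x)))"

text \<open>Quantifies over every unifier \<open>\<tau>\<close>, which spares the theory of most
  general unifiers here. The overlap of a rule with itself at the root is included.\<close>

definition overlaps_joinable :: "trs \<Rightarrow> bool" where
  "overlaps_joinable R \<longleftrightarrow> (\<forall>l r l' r' u C \<tau>. (l, r) \<in> R \<longrightarrow> (l', r') \<in> R \<longrightarrow>
     context_of 0 (ren_even l) u C \<longrightarrow> subst \<tau> u = subst \<tau> (ren_odd l') \<longrightarrow>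
     joinable R (subst \<tau> (ren_even r)) (subst \<tau> (fill 0 (ren_odd r') C)))"

lemma overlaps_joinable_imp_root_peak:
  assumes ov: "overlaps_joinable R" and "(l, r) \<in> R" and "rstep R (subst \<sigma> l) t"
  shows "joinable R (subst \<sigma> r) t"
proof -
  \<comment> \<open>Undoes the even renaming: \<open>x div 2 - 1\<close> inverts the map from
    \<open>x\<close> to \<open>Suc (Suc (x + x))\<close>.\<close>
  define \<sigma>' where "\<sigma>' = (\<lambda>x. \<sigma> (x div 2 - 1))"
  have ren: "subst \<sigma>' (ren_even a) = subst \<sigma> a" for a
    unfolding subst_subst by (rule subst_cong) (simp add: \<sigma>'_def flip: mult_2)
  have fresh: "0 \<notin> vars (ren_even l)" by (simp add: vars_subst)
  have "rstep R (subst \<sigma>' (ren_even l)) t" using assms(3) ren by simp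
  from rstep_subst_cases[OF this fresh] consider
    u C l' r' \<tau> where "context_of 0 (ren_even l) u C" "(l', r') \<in> R" "subst \<sigma>' u = subst \<tau> l'"
      "t = subst (\<sigma>'(0 := subst \<tau> r')) C"
    | x v where "rstep R (\<sigma>' x) v" "(rstep R)\<^sup>*\<^sup>* t (subst (\<sigma>'(x := v)) (ren_even l))"
    by blast
  then show ?thesis
  proof cases
    case 1
    \<comment> \<open>Glues the two matching substitutions into one unifier, possible because the
      rules were renamed to variables of different parity.\<close>
    define \<rho> where "\<rho> = (\<lambda>x. if even x then \<sigma>' x else \<tau> (x div 2))"
    have vars_u: "vars u \<subseteq> vars (ren_even l)" and vars_C: "vars C \<subseteq> insert 0 (vars (ren_even l))"
      using 1(1) by (induction rule: context_of.induct) auto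
    have even: "even x" if "x \<in> vars (ren_even l)" for x using that by (auto simp: vars_subst)
    have \<rho>_even: "subst \<rho> (ren_even a) = subst \<sigma> a" for a
      unfolding ren[symmetric] subst_subst by (rule subst_cong) (simp add: \<rho>_def flip: mult_2)
    have \<rho>_odd: "subst \<rho> (ren_odd a) = subst \<tau> a" for a
      unfolding subst_subst by (rule subst_cong) (simp add: \<rho>_def flip: mult_2)
    have "subst \<rho> u = subst \<sigma>' u"
      using vars_u even by (intro subst_cong) (auto simp: \<rho>_def)
    then have "subst \<rho> u = subst \<rho> (ren_odd l')" using 1(3) \<rho>_odd by simp
    then have "joinable R (subst \<rho> (ren_even r)) (subst \<rho> (fill 0 (ren_odd r') C))"
      using ov assms(2) 1(1,2) unfolding overlaps_joinable_def by blast
    moreover have "subst \<rho> (fill 0 (ren_odd r') C) = t"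
      unfolding subst_fill \<rho>_odd 1(4) using vars_C even by (intro subst_cong) (auto simp: \<rho>_def)
    ultimately show ?thesis using \<rho>_even by simp
  next
    case 2
    let ?\<sigma> = "\<sigma>'(x := v)"
    have "(rstep R)\<^sup>*\<^sup>* (subst \<sigma>' (ren_even r)) (subst ?\<sigma> (ren_even r))"
      using 2(1) by (intro rsteps_subst_pointwise) auto
    moreover have "rstep R (subst ?\<sigma> (ren_even l)) (subst ?\<sigma> (ren_even r))"
      using assms(2) by (intro rstep_subst rstep.root)
    then have "(rstep R)\<^sup>*\<^sup>* t (subst ?\<sigma> (ren_even r))"
      using 2(2) by (rule rtranclp.rtrancl_into_rtrancl[rotated])
    ultimately show ?thesis unfolding ren by (rule joinableI)
  qed
qed

lemma overlaps_joinable_imp_peak: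
  assumes ov: "overlaps_joinable R"
  shows "rstep R t t1 \<Longrightarrow> rstep R t t2 \<Longrightarrow> joinable R t1 t2"
proof (induction arbitrary: t2 rule: rstep.induct)
  case (root l r \<sigma>)
  then show ?case using overlaps_joinable_imp_root_peak[OF ov] by blast
next
  case (ctxt s t f ss us)
  note st = ctxt.hyps(1) and IH = ctxt.IH
  from ctxt.prems show ?case
  proof (cases rule: rstep.cases)
    case (root l r \<sigma>)
    have "rstep R (subst \<sigma> l) (Fun f (ss @ t # us))"
      using root(1) rstep.ctxt[OF st] by metis
    then show ?thesis
      using root overlaps_joinable_imp_root_peak[OF ov] joinable_sym by blast
  next
    case (ctxt s' t' ss' us')
    \<comment> \<open>Both steps are below the root: they act in the same argument, covered by the
      induction hypothesis, or in two different arguments in either order, where they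
      commute.\<close>
    from ctxt(1) consider "ss = ss'" "s = s'" "us = us'"
      | vs where "ss' = ss @ s # vs" "us = vs @ s' # us'"
      | vs where "ss = ss' @ s' # vs" "us' = vs @ s # us"
      by (auto simp: append_eq_append_conv2 append_eq_Cons_conv Cons_eq_append_conv)
    then show ?thesis
    proof cases
      case 1
      then show ?thesis
        using ctxt IH[of t'] unfolding joinable_def by (metis rsteps_ctxt)
    next
      case 2
      have "rstep R (Fun f (ss @ t # us)) (Fun f (ss @ t # vs @ t' # us'))"
        using rstep.ctxt[OF ctxt(3), of f "ss @ t # vs" us'] 2 by simp
      moreover have "rstep R t2 (Fun f (ss @ t # vs @ t' # us'))"
        using rstep.ctxt[OF st, of f ss "vs @ t' # us'"] 2 ctxt(2) by simp
      ultimately show ?thesis by (metis joinableI r_into_rtranclp)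
    next
      case 3
      have "rstep R (Fun f (ss @ t # us)) (Fun f (ss' @ t' # vs @ t # us))"
        using rstep.ctxt[OF ctxt(3), of f ss' "vs @ t # us"] 3 by simp
      moreover have "rstep R t2 (Fun f (ss' @ t' # vs @ t # us))"
        using rstep.ctxt[OF st, of f "ss' @ t' # vs" us] 3 ctxt(2) by simp
      ultimately show ?thesis by (metis joinableI r_into_rtranclp)
    qed
  qed
qed

lemma weakly_confluent_iff_overlaps_joinable: "weakly_confluent R \<longleftrightarrow> overlaps_joinable R"
proof
  assume wc: "weakly_confluent R"
  show "overlaps_joinable R"
    unfolding overlaps_joinable_def
  proof (intro allI impI)
    fix l r l' r' u C \<tau>
    assume rules: "(l, r) \<in> R" "(l', r') \<in> R" and C: "context_of 0 (ren_even l) u C"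
      and eq: "subst \<tau> u = subst \<tau> (ren_odd l')"
    have "rstep R (subst \<tau> (ren_even l)) (subst \<tau> (ren_even r))"
      using rules(1) by (intro rstep_subst rstep.root)
    moreover have "rstep R (subst \<tau> u) (subst \<tau> (ren_odd r'))"
      unfolding eq using rules(2) by (intro rstep_subst rstep.root)
    then have "rstep R (subst \<tau> (ren_even l)) (subst \<tau> (fill 0 (ren_odd r') C))"
      unfolding subst_fill using C by (intro context_of_rstep) (simp_all add: vars_subst)
    ultimately show "joinable R (subst \<tau> (ren_even r)) (subst \<tau> (fill 0 (ren_odd r') C))"
      using wc unfolding weakly_confluent_def weakly_confluent_on_iff_joinable by blast
  qed
next
  assume "overlaps_joinable R"
  then show "weakly_confluent R"
    unfolding weakly_confluent_def weakly_confluent_on_iff_joinable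
    using overlaps_joinable_imp_peak by blast
qed

section \<open>A finite complete set of unifiers\<close>

fun vlist :: "trm \<Rightarrow> nat list" where
  "vlist (Var x) = [x]"
| "vlist (Fun f ts) = concat (map vlist ts)"

fun subterms :: "trm \<Rightarrow> trm list" where
  "subterms (Var x) = [Var x]"
| "subterms (Fun f ts) = Fun f ts # concat (map subterms ts)"

text \<open>Substitutions as association lists, so that they have codes; a variable off the list
  stays fixed.\<close>

fun lookup :: "(nat \<times> trm) list \<Rightarrow> nat \<Rightarrow> trm" where
  "lookup [] x = Var x"
| "lookup (p # ps) x = (if x = fst p then snd p else lookup ps x)"

fun assignments :: "trm list \<Rightarrow> nat list \<Rightarrow> (nat \<times> trm) list list" where
  "assignments us [] = [[]]"
| "assignments us (x # xs) = concat (map (\<lambda>u. map (\<lambda>\<sigma>. (x, u) # \<sigma>) (assignments us xs)) us)"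

text \<open>The list argument serves only as a counter of iterations, in the form that
  \<open>cmp_rec_list\<close> handles.\<close>

fun iter_subst :: "(nat \<times> trm) list \<Rightarrow> nat list \<Rightarrow> trm \<Rightarrow> trm" where
  "iter_subst \<sigma> [] t = t"
| "iter_subst \<sigma> (x # xs) t = subst (lookup \<sigma>) (iter_subst \<sigma> xs t)"

lemma set_vlist: "set (vlist t) = vars t"
  by (induction t) auto

lemma self_in_subterms: "t \<in> set (subterms t)"
  by (cases t) auto

lemma subterms_args: "Fun f ts \<in> set (subterms t) \<Longrightarrow> set ts \<subseteq> set (subterms t)"
  by (induction t) (auto intro: self_in_subterms)

lemma Var_in_subterms: "Var x \<in> set (subterms t) \<longleftrightarrow> x \<in> vars t"
  by (induction t) auto

lemma subst_var_in_subterms: "x \<in> vars t \<Longrightarrow> \<sigma> x \<in> set (subterms (subst \<sigma> t))"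
  by (induction t) (auto simp: self_in_subterms)

lemma map_in_assignments:
  "(\<And>x. x \<in> set xs \<Longrightarrow> h x \<in> set us) \<Longrightarrow> map (\<lambda>x. (x, h x)) xs \<in> set (assignments us xs)"
  by (induction xs) auto

lemma lookup_map: "lookup (map (\<lambda>x. (x, h x)) xs) x = (if x \<in> set xs then h x else Var x)"
  by (induction xs) auto

lemma iter_subst_funpow: "iter_subst \<sigma> xs t = (subst (lookup \<sigma>) ^^ length xs) t"
  by (induction xs) auto

lemma funpow_subst_Fun: "(subst \<sigma> ^^ k) (Fun f ts) = Fun f (map (subst \<sigma> ^^ k) ts)"
  by (induction k) auto

text \<open>A unifier \<open>\<tau>\<close> groups the subterms of \<open>s\<close> and \<open>t\<close> into classes of equal instances.  Binding every
  variable to a representative of its class, a non-variable one if possible, yields a more general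
  unifier once the binding is iterated; the iteration stops because the instances of the variables
  shrink along it.  Hence the finitely many bindings of variables to subterms suffice.\<close>

lemma complete_unifiers:
  assumes unif: "subst \<tau> s = subst \<tau> t"
  defines "V \<equiv> vlist s @ vlist t"
  shows "\<exists>\<sigma>\<in>set (assignments (subterms s @ subterms t) V).
    iter_subst \<sigma> (0 # V) s = iter_subst \<sigma> (0 # V) t \<and>
    (\<forall>u. subst \<tau> (iter_subst \<sigma> (0 # V) u) = subst \<tau> u)"
proof -
  define S where "S = set (subterms s @ subterms t)"
  have S_args: "set us \<subseteq> S" if "Fun f us \<in> S" for f us
    using that subterms_args unfolding S_def by auto
  have S_Var: "Var x \<in> S \<longleftrightarrow> x \<in> set V" for x
    by (simp add: S_def V_def Var_in_subterms set_vlist)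
  define has_fun where "has_fun c \<longleftrightarrow> (\<exists>f us. Fun f us \<in> S \<and> subst \<tau> (Fun f us) = c)" for c
  define rep where "rep c = (if has_fun c then SOME v. \<exists>f us. v = Fun f us \<and> v \<in> S \<and> subst \<tau> v = c
    else SOME v. v \<in> S \<and> subst \<tau> v = c)" for c
  have rep_fun: "\<exists>f us. rep c = Fun f us \<and> rep c \<in> S \<and> subst \<tau> (rep c) = c" if "has_fun c" for c
  proof -
    have "\<exists>v f us. v = Fun f us \<and> v \<in> S \<and> subst \<tau> v = c" using that unfolding has_fun_def by blast
    from someI_ex[OF this] show ?thesis using that unfolding rep_def by simp
  qed
  have rep: "rep (subst \<tau> v) \<in> S \<and> subst \<tau> (rep (subst \<tau> v)) = subst \<tau> v" if "v \<in> S" for v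
  proof (cases "has_fun (subst \<tau> v)")
    case True
    then show ?thesis using rep_fun by blast
  next
    case False
    have "\<exists>w. w \<in> S \<and> subst \<tau> w = subst \<tau> v" using that by blast
    from someI_ex[OF this] show ?thesis using False unfolding rep_def by simp
  qed
  define \<sigma> where "\<sigma> = map (\<lambda>x. (x, rep (\<tau> x))) V"
  define \<theta> where "\<theta> = (\<lambda>k. subst (lookup \<sigma>) ^^ k)"
  have \<sigma>_in: "\<sigma> \<in> set (assignments (subterms s @ subterms t) V)"
    unfolding \<sigma>_def using rep[of "Var _"] S_Var by (intro map_in_assignments) (auto simp: S_def)
  have lookup: "lookup \<sigma> x = (if x \<in> set V then rep (\<tau> x) else Var x)" for x
    unfolding \<sigma>_def by (rule lookup_map)
  have \<theta>_Fun: "\<theta> k (Fun f us) = Fun f (map (\<theta> k) us)" for k f us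
    by (simp add: \<theta>_def funpow_subst_Fun)
  have \<theta>_Var: "\<theta> (Suc k) (Var x) = \<theta> k (rep (\<tau> x))" if "x \<in> set V" for k x
    using that by (simp add: \<theta>_def funpow_Suc_right lookup del: funpow.simps)
  have \<tau>_lookup: "subst \<tau> (lookup \<sigma> x) = \<tau> x" for x
    using rep[of "Var x"] S_Var by (simp add: lookup)
  have \<tau>_\<theta>: "subst \<tau> (\<theta> k u) = subst \<tau> u" for k u
    by (induction k) (simp_all add: \<theta>_def subst_subst \<tau>_lookup)
  \<comment> \<open>The budget of iterations for a term whose instance has size \<open>n\<close>.
    Replacing a variable \<open>x\<close> by a non-variable representative uses one iteration, and
    the arguments reached have instances smaller than \<open>\<tau> x\<close>; then \<open>x\<close>
    itself is no longer counted, so \<open>K\<close> drops and pays for it.\<close>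
  define K where "K n = card {y \<in> set V. size (\<tau> y) \<le> n}" for n
  have K_mono: "K m \<le> K n" if "m \<le> n" for m n
    unfolding K_def using that by (intro card_mono) auto
  have K_less: "K m < K (size (\<tau> x))" if "x \<in> set V" "m < size (\<tau> x)" for m x
  proof -
    have "x \<in> {y \<in> set V. size (\<tau> y) \<le> size (\<tau> x)} - {y \<in> set V. size (\<tau> y) \<le> m}"
      using that by simp
    moreover have "{y \<in> set V. size (\<tau> y) \<le> m} \<subseteq> {y \<in> set V. size (\<tau> y) \<le> size (\<tau> x)}"
      using that(2) by auto
    ultimately show ?thesis unfolding K_def by (intro psubset_card_mono) (simp, blast)
  qed
  have size_arg: "size (subst \<tau> u) < size (subst \<tau> (Fun f us))" if "u \<in> set us" for u f us
    using that by (auto simp: less_Suc_eq_le intro!: size_list_estimation')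
  have expand: "\<exists>f us k'. Fun f us \<in> S \<and> subst \<tau> (Fun f us) = subst \<tau> u \<and>
      \<theta> k u = Fun f (map (\<theta> k') us) \<and> (\<forall>v\<in>set us. K (size (subst \<tau> v)) < k')"
    if uS: "u \<in> S" and uK: "K (size (subst \<tau> u)) < k" and u_fun: "has_fun (subst \<tau> u)" for u k
  proof (cases u)
    case (Fun f us)
    have "K (size (subst \<tau> v)) < k" if "v \<in> set us" for v
      using K_mono[OF less_imp_le[OF size_arg[OF that, of f]]] Fun uK by simp
    then show ?thesis using uS Fun \<theta>_Fun by blast
  next
    case (Var x)
    then have x: "x \<in> set V" using uS S_Var Var by simp
    obtain f us where r: "rep (\<tau> x) = Fun f us" "Fun f us \<in> S" "subst \<tau> (Fun f us) = \<tau> x"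
      using rep_fun[of "\<tau> x"] u_fun Var by auto
    obtain k' where k': "k = Suc k'" using uK by (cases k) auto
    have "K (size (subst \<tau> v)) < k'" if "v \<in> set us" for v
      using K_less[OF x size_arg[OF that, of f, unfolded r(3)]] Var k' uK by simp
    then show ?thesis using r Var k' \<theta>_Var[OF x] \<theta>_Fun by (metis subst.simps(1))
  qed
  \<comment> \<open>A class that consists of variables only: its representative is a variable bound
    to itself, so the iteration is stable after one round.\<close>
  have collapse: "\<theta> k u = rep (subst \<tau> u)"
    if uS: "u \<in> S" and uK: "K (size (subst \<tau> u)) < k" and u_fun: "\<not> has_fun (subst \<tau> u)" for u k
  proof -
    have var: "\<exists>x. v = Var x" if "v \<in> S" "subst \<tau> v = subst \<tau> u" for v
      using that u_fun unfolding has_fun_def by (cases v) auto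
    then obtain x where x: "u = Var x" using uS by blast
    obtain z where z: "rep (subst \<tau> u) = Var z" using var rep[OF uS] by blast
    have zV: "z \<in> set V" "\<tau> z = \<tau> x" using rep[OF uS] z S_Var x by auto
    have "\<theta> m (Var z) = Var z" for m
    proof (induction m)
      case (Suc m)
      then show ?case using \<theta>_Var[OF zV(1)] zV(2) z x by simp
    qed (simp add: \<theta>_def)
    moreover obtain k' where "k = Suc k'" using uK by (cases k) auto
    moreover have "x \<in> set V" using uS x S_Var by simp
    ultimately show ?thesis using \<theta>_Var z x by simp
  qed
  \<comment> \<open>Two independent counts are needed: a variable on one side may face a compound
    term on the other, and then only one side spends an iteration.\<close>
  have main: "\<theta> k u = \<theta> j v" if "u \<in> S" "v \<in> S" "subst \<tau> u = subst \<tau> v"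
    "K (size (subst \<tau> u)) < k" "K (size (subst \<tau> u)) < j" for u v k j
    using that
  proof (induction "size (subst \<tau> u)" arbitrary: u v k j rule: less_induct)
    case less
    show ?case
    proof (cases "has_fun (subst \<tau> u)")
      case True
      obtain f us k' where u: "Fun f us \<in> S" "subst \<tau> (Fun f us) = subst \<tau> u"
        "\<theta> k u = Fun f (map (\<theta> k') us)" "\<forall>w\<in>set us. K (size (subst \<tau> w)) < k'"
        using expand[OF less.prems(1,4) True] by blast
      obtain g vs j' where v: "Fun g vs \<in> S" "subst \<tau> (Fun g vs) = subst \<tau> v"
        "\<theta> j v = Fun g (map (\<theta> j') vs)" "\<forall>w\<in>set vs. K (size (subst \<tau> w)) < j'"
        using expand[of v j] less.prems True by auto
      have "subst \<tau> (Fun f us) = subst \<tau> (Fun g vs)" using u(2) v(2) less.prems(3) by argo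
      then have fg: "f = g" "map (subst \<tau>) us = map (subst \<tau>) vs" by simp_all
      then have len: "length us = length vs" by (metis length_map)
      have "\<theta> k' (us ! i) = \<theta> j' (vs ! i)" if "i < length us" for i
      proof (rule less.hyps)
        have eq: "subst \<tau> (us ! i) = subst \<tau> (vs ! i)" using fg(2) len that by (metis nth_map)
        then show "subst \<tau> (us ! i) = subst \<tau> (vs ! i)" .
        show "size (subst \<tau> (us ! i)) < size (subst \<tau> u)"
          using size_arg[of "us ! i" us f] that unfolding u(2) by simp
        show "us ! i \<in> S" "vs ! i \<in> S"
          using S_args[OF u(1)] S_args[OF v(1)] that len by (auto dest: nth_mem)
        show "K (size (subst \<tau> (us ! i))) < k'" using u(4) that by simp
        show "K (size (subst \<tau> (us ! i))) < j'" unfolding eq using v(4) that len by simp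
      qed
      then have "map (\<theta> k') us = map (\<theta> j') vs" using len by (simp add: list_eq_iff_nth_eq)
      then show ?thesis using u(3) v(3) fg(1) by simp
    next
      case False
      then show ?thesis using collapse less.prems by simp
    qed
  qed
  \<comment> \<open>\<open>K\<close> never exceeds the number of variables; the extra entry
    \<open>0\<close> makes the inequality strict, as \<open>main\<close> demands.\<close>
  have "K n < length (0 # V)" for n
  proof -
    have "K n \<le> card (set V)" unfolding K_def by (intro card_mono) auto
    also have "\<dots> \<le> length V" by (rule card_length)
    finally show ?thesis by simp
  qed
  then have "\<theta> (length (0 # V)) s = \<theta> (length (0 # V)) t"
    using unif self_in_subterms by (intro main) (auto simp: S_def)
  then show ?thesis
    using \<sigma>_in \<tau>_\<theta> unfolding iter_subst_funpow \<theta>_def by blast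
qed

section \<open>Weak confluence is semidecidable\<close>

text \<open>Each argument comes with its own contexts, the shape delivered by
  \<open>cmp_rec_trm\<close>; the result lists all ways to put a context into exactly one argument
  position.\<close>

fun plug_args :: "(trm \<times> (trm \<times> trm) list) list \<Rightarrow> (trm \<times> trm list) list" where
  "plug_args [] = []"
| "plug_args (p # ps) = map (\<lambda>v. (fst v, snd v # map fst ps)) (snd p) @
     map (\<lambda>v. (fst v, fst p # snd v)) (plug_args ps)"

fun contexts :: "nat \<Rightarrow> trm \<Rightarrow> (trm \<times> trm) list" where
  "contexts n (Var x) = []"
| "contexts n (Fun f ts) = (Fun f ts, Var n) #
     map (\<lambda>v. (fst v, Fun f (snd v))) (plug_args (map (\<lambda>t. (t, contexts n t)) ts))"

lemma set_plug_args:
  "(u, cs) \<in> set (plug_args (map (\<lambda>t. (t, h t)) ts)) \<longleftrightarrow>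
    (\<exists>ss t us c. ts = ss @ t # us \<and> (u, c) \<in> set (h t) \<and> cs = ss @ c # us)"
proof (induction ts arbitrary: cs)
  case (Cons t ts)
  have "(u, cs) \<in> set (plug_args (map (\<lambda>t. (t, h t)) (t # ts))) \<longleftrightarrow>
      (\<exists>c. (u, c) \<in> set (h t) \<and> cs = c # ts) \<or>
      (\<exists>cs'. (u, cs') \<in> set (plug_args (map (\<lambda>t. (t, h t)) ts)) \<and> cs = t # cs')"
    by (force simp: comp_def)
  also have "\<dots> \<longleftrightarrow> (\<exists>ss t' us c. t # ts = ss @ t' # us \<and> (u, c) \<in> set (h t') \<and> cs = ss @ c # us)"
    (is "?L \<longleftrightarrow> ?R")
  proof
    assume ?L
    then show ?R
      unfolding Cons.IH by (metis append_Cons append_Nil)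
  next
    assume ?R
    then obtain ss t' us c where *: "t # ts = ss @ t' # us" "(u, c) \<in> set (h t')" "cs = ss @ c # us"
      by blast
    then show ?L unfolding Cons.IH by (cases ss) auto
  qed
  finally show ?case .
qed simp

lemma set_contexts: "(u, C) \<in> set (contexts n t) \<longleftrightarrow> context_of n t u C"
proof
  show "(u, C) \<in> set (contexts n t) \<Longrightarrow> context_of n t u C"
  proof (induction t arbitrary: C)
    case (Fun f ts)
    then consider "u = Fun f ts" "C = Var n"
      | cs where "(u, cs) \<in> set (plug_args (map (\<lambda>t. (t, contexts n t)) ts))" "C = Fun f cs"
      by auto
    then show ?case
    proof cases
      case 1
      then show ?thesis by (simp add: context_root)
    next
      case 2
      then obtain ss t us c where "ts = ss @ t # us" "(u, c) \<in> set (contexts n t)" "C = Fun f (ss @ c # us)"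
        unfolding set_plug_args by blast
      then show ?thesis using Fun.IH by (auto intro: context_arg)
    qed
  qed simp
next
  show "context_of n t u C \<Longrightarrow> (u, C) \<in> set (contexts n t)"
  proof (induction rule: context_of.induct)
    case (context_arg t u C f ss us)
    then have "(u, ss @ C # us) \<in> set (plug_args (map (\<lambda>t. (t, contexts n t)) (ss @ t # us)))"
      unfolding set_plug_args by blast
    then show ?case by (force simp del: map_append list.map)
  qed simp
qed

lemma cmp_vlist: "cmp f \<Longrightarrow> cmp (\<lambda>x. vlist (f x))"
  by (rule cmp_rec_trm[where F = "\<lambda>_. vlist" and a = "\<lambda>_ x. [x]" and b = "\<lambda>_ _ ps. concat (map snd ps)"
        and f = "\<lambda>_. 0 :: nat"])
    (simp_all add: comp_def, (intro cmp_intros cmp_concat cmp_map)+)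

lemma cmp_subterms: "cmp f \<Longrightarrow> cmp (\<lambda>x. subterms (f x))"
  by (rule cmp_rec_trm[where F = "\<lambda>_. subterms" and a = "\<lambda>_ x. [Var x]"
        and b = "\<lambda>_ k ps. Fun k (map fst ps) # concat (map snd ps)" and f = "\<lambda>_. 0 :: nat"])
    (simp_all add: comp_def map_idI, (intro cmp_intros cmp_concat cmp_map cmp_Fun cmp_Var)+)

lemma cmp_subst:
  assumes "cmp (\<lambda>z. h (fst z) (snd z))" "cmp g"
  shows "cmp (\<lambda>x. subst (h x) (g x))"
  by (rule cmp_rec_trm[where F = "\<lambda>e. subst (h e)" and a = h
        and b = "\<lambda>_ k ps. Fun k (map snd ps)" and f = "\<lambda>x. x"])
    (simp_all add: comp_def assms, (intro cmp_intros cmp_map cmp_Fun)+)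

lemma cmp_lookup: "cmp f \<Longrightarrow> cmp g \<Longrightarrow> cmp (\<lambda>x. lookup (f x) (g x))"
  by (rule cmp_rec_list[where F = "\<lambda>x \<sigma>. lookup \<sigma> x" and a = Var
        and b = "\<lambda>x p _ r. if x = fst p then snd p else r"])
    (simp_all, (intro cmp_intros cmp_if_eq cmp_Var)+)

lemma cmp_plug_args: "cmp f \<Longrightarrow> cmp (\<lambda>x. plug_args (f x))"
  by (rule cmp_rec_list[where F = "\<lambda>_. plug_args" and a = "\<lambda>_. []" and f = "\<lambda>_. 0 :: nat"
        and b = "\<lambda>_ p ps r. map (\<lambda>v. (fst v, snd v # map fst ps)) (snd p) @ map (\<lambda>v. (fst v, fst p # snd v)) r"])
    (simp_all, (intro cmp_intros cmp_append cmp_map)+)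

lemma cmp_contexts: "cmp f \<Longrightarrow> cmp g \<Longrightarrow> cmp (\<lambda>x. contexts (f x) (g x))"
  by (rule cmp_rec_trm[where F = contexts and a = "\<lambda>_ _. []"
        and b = "\<lambda>n k ps. (Fun k (map fst ps), Var n) # map (\<lambda>v. (fst v, Fun k (snd v))) (plug_args ps)"])
    (simp_all add: comp_def map_idI, (intro cmp_intros cmp_plug_args cmp_map cmp_Fun cmp_Var)+)

lemma cmp_assignments: "cmp f \<Longrightarrow> cmp g \<Longrightarrow> cmp (\<lambda>x. assignments (f x) (g x))"
  by (rule cmp_rec_list[where F = assignments and a = "\<lambda>_. [[]]"
        and b = "\<lambda>us x _ r. concat (map (\<lambda>u. map (\<lambda>\<sigma>. (x, u) # \<sigma>) r) us)"])
    (simp_all, (intro cmp_intros cmp_concat cmp_map)+)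

lemma cmp_iter_subst:
  assumes "cmp f" "cmp g" "cmp h"
  shows "cmp (\<lambda>x. iter_subst (f x) (g x) (h x))"
proof -
  have "cmp (\<lambda>x. (\<lambda>e xs. iter_subst (fst e) xs (snd e)) (f x, h x) (g x))"
    by (rule cmp_rec_list[where a = snd and b = "\<lambda>e _ _ r. subst (lookup (fst e)) r"])
      (simp_all add: assms cmp_pair, (intro cmp_intros cmp_subst cmp_lookup)+)
  then show ?thesis by simp
qed

lemma cmp_fill:
  assumes "cmp f" "cmp g" "cmp h"
  shows "cmp (\<lambda>x. fill (f x) (g x) (h x))"
  unfolding fill_def
  by (intro cmp_subst cmp_if_eq cmp_Var cmp_comp[OF assms(1)] cmp_comp[OF assms(2)]
      cmp_comp[OF assms(3)] cmp_intros)

lemmas cmp_term_intros = cmp_fill cmp_iter_subst cmp_assignments cmp_contexts cmp_subst cmp_lookup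
  cmp_vlist cmp_subterms cmp_append cmp_Var cmp_Fun cmp_intros

section \<open>Certificates for rewriting, joinability and overlaps\<close>

definition step_cert :: "(trm \<times> trm) list \<Rightarrow> trm \<Rightarrow> trm \<Rightarrow> bool" where
  "step_cert rs s t \<longleftrightarrow> (\<exists>n. (\<forall>y\<in>set (vlist s). y \<noteq> n) \<and> (\<exists>p\<in>set (contexts n s). \<exists>q\<in>set rs.
     \<exists>\<sigma>. fst p = subst (lookup \<sigma>) (fst q) \<and> t = fill n (subst (lookup \<sigma>) (snd q)) (snd p)))"

definition nonvar_lhs :: "(trm \<times> trm) list \<Rightarrow> bool" where
  "nonvar_lhs rs \<longleftrightarrow> (\<forall>q\<in>set rs. \<exists>f ts. fst q = Fun f ts)"

text \<open>The case \<open>\<sigma> = Var\<close> of \<open>rstep_subst_cases\<close>: its second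
  alternative would rewrite a variable, which is impossible when all left-hand sides are
  compound.\<close>

lemma rstep_iff_context_of:
  assumes R: "\<forall>l r. (l, r) \<in> R \<longrightarrow> (\<exists>f ts. l = Fun f ts)" and fresh: "n \<notin> vars s"
  shows "rstep R s t \<longleftrightarrow> (\<exists>u C l r \<sigma>. context_of n s u C \<and> (l, r) \<in> R \<and> u = subst \<sigma> l \<and>
    t = fill n (subst \<sigma> r) C)" (is "_ \<longleftrightarrow> ?rhs")
proof
  assume "rstep R s t"
  then have "rstep R (subst Var s) t" by (simp add: subst_Var)
  from rstep_subst_cases[OF this fresh] show ?rhs
  proof (elim disjE exE conjE)
    fix x v assume "rstep R (Var x) v"
    then show ?rhs
    proof (cases rule: rstep.cases)
      case (root l r \<sigma>)
      then show ?thesis using R by fastforce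
    qed
  next
    fix u C l r \<tau>
    assume *: "context_of n s u C" "(l, r) \<in> R" "subst Var u = subst \<tau> l" "t = subst (Var(n := subst \<tau> r)) C"
    have "t = fill n (subst \<tau> r) C"
      unfolding fill_def *(4) by (rule subst_cong) simp
    then show ?rhs using *(1-3) unfolding subst_Var by blast
  qed
next
  assume ?rhs
  then obtain u C l r \<sigma> where *: "context_of n s u C" "(l, r) \<in> R" "u = subst \<sigma> l" "t = fill n (subst \<sigma> r) C"
    by blast
  have "rstep R (subst Var s) (subst (Var(n := subst \<sigma> r)) C)"
    using * by (intro context_of_rstep[OF *(1) fresh]) (auto simp: subst_Var intro: rstep.root)
  moreover have "subst (Var(n := subst \<sigma> r)) C = t"
    unfolding fill_def *(4) by (rule subst_cong) simp
  ultimately show "rstep R s t" by (simp add: subst_Var)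
qed

lemma finite_vars: "finite (vars t)"
  by (induction t) auto

lemma step_cert_iff:
  assumes "nonvar_lhs rs"
  shows "step_cert rs s t \<longleftrightarrow> rstep (set rs) s t"
proof -
  have R: "\<forall>l r. (l, r) \<in> set rs \<longrightarrow> (\<exists>f ts. l = Fun f ts)"
    using assms unfolding nonvar_lhs_def by fastforce
  show ?thesis
  proof
    assume "step_cert rs s t"
    then obtain n p q \<sigma> where "n \<notin> vars s" "p \<in> set (contexts n s)" "q \<in> set rs"
      "fst p = subst (lookup \<sigma>) (fst q)" "t = fill n (subst (lookup \<sigma>) (snd q)) (snd p)"
      unfolding step_cert_def set_vlist by blast
    then show "rstep (set rs) s t"
      using rstep_iff_context_of[OF R, of n s] set_contexts[of "fst p" "snd p" n s]
      by (metis prod.collapse)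
  next
    assume "rstep (set rs) s t"
    obtain n where n: "n \<notin> vars s" using finite_vars ex_new_if_finite infinite_UNIV_nat by metis
    then obtain u C l r \<sigma> where *: "context_of n s u C" "(l, r) \<in> set rs" "u = subst \<sigma> l"
      "t = fill n (subst \<sigma> r) C"
      using rstep_iff_context_of[OF R n, of t] \<open>rstep (set rs) s t\<close> by blast
    \<comment> \<open>Only the variables of the rule matter. Those of \<open>r\<close> are listed as
      well, because \<open>nonvar_lhs\<close> does not confine them to \<open>l\<close>.\<close>
    define \<tau> where "\<tau> = map (\<lambda>x. (x, \<sigma> x)) (vlist l @ vlist r)"
    have "subst (lookup \<tau>) l = subst \<sigma> l" "subst (lookup \<tau>) r = subst \<sigma> r"
      unfolding \<tau>_def lookup_map by (intro subst_cong; simp add: set_vlist)+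
    then show "step_cert rs s t"
      using * n unfolding step_cert_def set_vlist set_contexts[symmetric]
      by (intro exI[of _ n] conjI bexI[of _ "(u, C)"] bexI[of _ "(l, r)"] exI[of _ \<tau>]) auto
  qed
qed

lemma RE_step_cert: "cmp f \<Longrightarrow> cmp g \<Longrightarrow> cmp h \<Longrightarrow> RE (\<lambda>x. step_cert (f x) (g x) (h x))"
proof -
  have "RE (\<lambda>z. step_cert (fst z) (fst (snd z)) (snd (snd z)))"
    unfolding step_cert_def by (intro RE_intros cmp_term_intros)
  from RE_subst[OF this, of "\<lambda>x. (f x, g x, h x)"]
  show "cmp f \<Longrightarrow> cmp g \<Longrightarrow> cmp h \<Longrightarrow> ?thesis" by (simp add: cmp_pair)
qed

lemma RE_rtranclp_step_cert:
  assumes "cmp f" "cmp g" "cmp h"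
  shows "RE (\<lambda>x. (step_cert (f x))\<^sup>*\<^sup>* (g x) (h x))"
proof -
  define Step :: "(trm \<times> trm) list \<times> trm \<times> trm \<Rightarrow> ((trm \<times> trm) list \<times> trm \<times> trm) list \<Rightarrow> bool" where
    "Step q ps \<longleftrightarrow> fst (snd q) = snd (snd q) \<or>
      (\<exists>u. step_cert (fst q) (fst (snd q)) u \<and> (fst q, u, snd (snd q)) \<in> set ps)" for q ps
  have "RE (\<lambda>z. Step (fst z) (snd z))"
    unfolding Step_def by (intro RE_intros RE_step_cert cmp_intros)
  then have "RE (Der Step)" by (rule RE_Der)
  moreover have "Der Step q \<Longrightarrow> (step_cert (fst q))\<^sup>*\<^sup>* (fst (snd q)) (snd (snd q))" for q
  proof (induction rule: Der.induct)
    case (DerI q ps)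
    then show ?case unfolding Step_def by (fastforce intro: converse_rtranclp_into_rtranclp)
  qed
  moreover have "Der Step (rs, s, t)" if "(step_cert rs)\<^sup>*\<^sup>* s t" for rs s t
    using that
  proof (induction rule: converse_rtranclp_induct)
    case base
    show ?case by (rule DerI[of _ _ "[]"]) (auto simp: Step_def)
  next
    case (step s u)
    show ?case by (rule DerI[of _ _ "[(rs, u, t)]"]) (use step in \<open>auto simp: Step_def\<close>)
  qed
  ultimately have "RE (\<lambda>z. (step_cert (fst z))\<^sup>*\<^sup>* (fst (snd z)) (snd (snd z)))"
    by (rule_tac back_subst[of RE]) (auto simp: fun_eq_iff)
  from RE_subst[OF this, of "\<lambda>x. (f x, g x, h x)"] show ?thesis by (simp add: assms cmp_pair)
qed

definition join_cert :: "(trm \<times> trm) list \<Rightarrow> trm \<Rightarrow> trm \<Rightarrow> bool" where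
  "join_cert rs s t \<longleftrightarrow> (\<exists>d. (step_cert rs)\<^sup>*\<^sup>* s d \<and> (step_cert rs)\<^sup>*\<^sup>* t d)"

lemma join_cert_iff:
  assumes "nonvar_lhs rs"
  shows "join_cert rs s t \<longleftrightarrow> joinable (set rs) s t"
proof -
  have "step_cert rs = rstep (set rs)" using step_cert_iff[OF assms] by (intro ext)
  then show ?thesis unfolding join_cert_def joinable_def by simp
qed

lemma RE_join_cert:
  assumes "cmp f" "cmp g" "cmp h"
  shows "RE (\<lambda>x. join_cert (f x) (g x) (h x))"
  unfolding join_cert_def
  by (intro RE_intros RE_rtranclp_step_cert cmp_comp[OF assms(1)] cmp_comp[OF assms(2)]
      cmp_comp[OF assms(3)] cmp_intros)

definition is_trs_cert :: "(trm \<times> trm) list \<Rightarrow> bool" where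
  "is_trs_cert rs \<longleftrightarrow> (\<forall>q\<in>set rs. (\<exists>f ts. fst q = Fun f ts) \<and>
     (\<forall>y\<in>set (vlist (snd q)). y \<in> set (vlist (fst q))))"

lemma is_trs_cert_iff: "is_trs_cert rs \<longleftrightarrow> is_trs (set rs)"
  unfolding is_trs_cert_def is_trs_def set_vlist by (auto simp: subset_iff case_prod_beta)

lemma is_trs_nonvar_lhs: "is_trs (set rs) \<Longrightarrow> nonvar_lhs rs"
  unfolding is_trs_def nonvar_lhs_def by fastforce

lemma RE_is_trs_cert: "cmp f \<Longrightarrow> RE (\<lambda>x. is_trs_cert (f x))"
proof -
  have "RE is_trs_cert"
    unfolding is_trs_cert_def[abs_def] by (intro RE_intros cmp_term_intros)
  then show "cmp f \<Longrightarrow> ?thesis" by (rule RE_subst)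
qed

text \<open>All universal quantifiers range over computed lists. A candidate that fails to unify
  passes by the inequality, which stands in for the premise of an implication.\<close>

definition overlaps_cert :: "(trm \<times> trm) list \<Rightarrow> bool" where
  "overlaps_cert rs \<longleftrightarrow> (\<forall>q\<in>set rs. \<forall>q'\<in>set rs. \<forall>p\<in>set (contexts 0 (ren_even (fst q))).
     \<forall>\<sigma>\<in>set (assignments (subterms (fst p) @ subterms (ren_odd (fst q')))
        (vlist (fst p) @ vlist (ren_odd (fst q')))).
     iter_subst \<sigma> (0 # vlist (fst p) @ vlist (ren_odd (fst q'))) (fst p) \<noteq>
       iter_subst \<sigma> (0 # vlist (fst p) @ vlist (ren_odd (fst q'))) (ren_odd (fst q')) \<or>
     join_cert rs (iter_subst \<sigma> (0 # vlist (fst p) @ vlist (ren_odd (fst q'))) (ren_even (snd q)))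
       (iter_subst \<sigma> (0 # vlist (fst p) @ vlist (ren_odd (fst q'))) (fill 0 (ren_odd (snd q')) (snd p))))"

lemma RE_overlaps_cert: "RE overlaps_cert"
  unfolding overlaps_cert_def[abs_def] by (intro RE_intros RE_join_cert cmp_term_intros)

lemma iter_subst_eq_subst: "iter_subst \<sigma> xs t = subst (\<lambda>x. iter_subst \<sigma> xs (Var x)) t"
proof (induction xs)
  case (Cons x xs)
  show ?case by (simp add: Cons.IH subst_subst)
qed (simp add: subst_Var)

text \<open>An iterated binding is itself a substitution, so each successful candidate is one of the
  unifiers of \<open>overlaps_joinable\<close>. Conversely a unifier \<open>\<tau>\<close> absorbs
  the candidate supplied by \<open>complete_unifiers\<close>, and applying \<open>\<tau>\<close> to
  the joined candidate pair gives the required one.\<close>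

lemma overlaps_cert_iff:
  assumes "nonvar_lhs rs"
  shows "overlaps_cert rs \<longleftrightarrow> overlaps_joinable (set rs)"
proof
  assume ov: "overlaps_joinable (set rs)"
  show "overlaps_cert rs"
    unfolding overlaps_cert_def join_cert_iff[OF assms]
  proof (intro ballI)
    fix q q' p :: "trm \<times> trm" and \<sigma>
    let ?V = "0 # vlist (fst p) @ vlist (ren_odd (fst q'))"
    assume "q \<in> set rs" "q' \<in> set rs" "p \<in> set (contexts 0 (ren_even (fst q)))"
    then have "subst \<tau> (fst p) = subst \<tau> (ren_odd (fst q')) \<Longrightarrow>
      joinable (set rs) (subst \<tau> (ren_even (snd q))) (subst \<tau> (fill 0 (ren_odd (snd q')) (snd p)))" for \<tau>
      using ov[unfolded overlaps_joinable_def, rule_format, of "fst q" "snd q" "fst q'" "snd q'" "fst p" "snd p"]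
      by (simp flip: set_contexts)
    moreover define \<tau> where "\<tau> = (\<lambda>x. iter_subst \<sigma> ?V (Var x))"
    have "iter_subst \<sigma> ?V t = subst \<tau> t" for t
      unfolding \<tau>_def by (rule iter_subst_eq_subst)
    ultimately show "iter_subst \<sigma> ?V (fst p) \<noteq> iter_subst \<sigma> ?V (ren_odd (fst q')) \<or>
      joinable (set rs) (iter_subst \<sigma> ?V (ren_even (snd q)))
        (iter_subst \<sigma> ?V (fill 0 (ren_odd (snd q')) (snd p)))"
      by presburger
  qed
next
  assume ov: "overlaps_cert rs"
  show "overlaps_joinable (set rs)"
    unfolding overlaps_joinable_def
  proof (intro allI impI)
    fix l r l' r' u C \<tau>
    assume rules: "(l, r) \<in> set rs" "(l', r') \<in> set rs" and C: "context_of 0 (ren_even l) u C"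
      and eq: "subst \<tau> u = subst \<tau> (ren_odd l')"
    let ?V = "0 # vlist u @ vlist (ren_odd l')"
    obtain \<sigma> where \<sigma>: "\<sigma> \<in> set (assignments (subterms u @ subterms (ren_odd l')) (vlist u @ vlist (ren_odd l')))"
      "iter_subst \<sigma> ?V u = iter_subst \<sigma> ?V (ren_odd l')"
      "\<And>t. subst \<tau> (iter_subst \<sigma> ?V t) = subst \<tau> t"
      using complete_unifiers[OF eq] by blast
    have "joinable (set rs) (iter_subst \<sigma> ?V (ren_even r)) (iter_subst \<sigma> ?V (fill 0 (ren_odd r') C))"
      using ov[unfolded overlaps_cert_def join_cert_iff[OF assms], rule_format, OF rules, of "(u, C)" \<sigma>]
        C \<sigma>(1,2) by (simp add: set_contexts)
    from joinable_subst[OF this, of \<tau>]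
    show "joinable (set rs) (subst \<tau> (ren_even r)) (subst \<tau> (fill 0 (ren_odd r') C))"
      by (simp only: \<sigma>(3))
  qed
qed

lemma RE_weakly_confluent: "RE (\<lambda>rs. is_trs (set rs) \<and> weakly_confluent (set rs))"
proof -
  have "is_trs (set rs) \<and> weakly_confluent (set rs) \<longleftrightarrow> is_trs_cert rs \<and> overlaps_cert rs" for rs
    using is_trs_nonvar_lhs overlaps_cert_iff
    by (auto simp: is_trs_cert_iff weakly_confluent_iff_overlaps_joinable)
  then show ?thesis
    by (simp add: RE_conj RE_is_trs_cert[OF cmp_id] RE_overlaps_cert)
qed

section \<open>Weak confluence on a single term\<close>

definition peaks_cert :: "(trm \<times> trm) list \<Rightarrow> trm \<Rightarrow> bool" where
  "peaks_cert rs t \<longleftrightarrow> (\<exists>n. (\<forall>y\<in>set (vlist t). y \<noteq> n) \<and>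
     (\<forall>p\<in>set (contexts n t). \<forall>q\<in>set rs. \<forall>\<sigma>\<in>set (assignments (subterms (fst p)) (vlist (fst q))).
        fst p \<noteq> subst (lookup \<sigma>) (fst q) \<or>
      (\<forall>p'\<in>set (contexts n t). \<forall>q'\<in>set rs. \<forall>\<sigma>'\<in>set (assignments (subterms (fst p')) (vlist (fst q'))).
        fst p' \<noteq> subst (lookup \<sigma>') (fst q') \<or>
        join_cert rs (fill n (subst (lookup \<sigma>) (snd q)) (snd p))
          (fill n (subst (lookup \<sigma>') (snd q')) (snd p')))))"

lemma RE_peaks_cert: "RE (\<lambda>z. peaks_cert (fst z) (snd z))"
  unfolding peaks_cert_def by (intro RE_intros RE_join_cert cmp_term_intros)

text \<open>Unlike in \<open>step_cert\<close>, the matching substitution must range over a finite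
  list, since peaks quantify universally over steps. Matching sends the variables of
  \<open>l\<close> to subterms of the redex, and \<open>is_trs\<close> leaves no further variables
  in \<open>r\<close>.\<close>

lemma rstep_iff_assignment:
  assumes R: "is_trs (set rs)" and n: "n \<notin> vars s"
  shows "rstep (set rs) s t \<longleftrightarrow> (\<exists>p\<in>set (contexts n s). \<exists>q\<in>set rs.
    \<exists>\<sigma>\<in>set (assignments (subterms (fst p)) (vlist (fst q))).
      fst p = subst (lookup \<sigma>) (fst q) \<and> t = fill n (subst (lookup \<sigma>) (snd q)) (snd p))"
    (is "_ \<longleftrightarrow> ?rhs")
proof -
  have lhs: "\<forall>l r. (l, r) \<in> set rs \<longrightarrow> (\<exists>f ts. l = Fun f ts)"
    using R unfolding is_trs_def by fastforce
  have vars: "vars r \<subseteq> vars l" if "(l, r) \<in> set rs" for l r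
    using R that unfolding is_trs_def by fastforce
  show ?thesis
  proof
    assume "rstep (set rs) s t"
    then obtain u C l r \<sigma> where *: "context_of n s u C" "(l, r) \<in> set rs" "u = subst \<sigma> l"
      "t = fill n (subst \<sigma> r) C"
      using rstep_iff_context_of[OF lhs n, of t] by blast
    define \<tau> where "\<tau> = map (\<lambda>x. (x, \<sigma> x)) (vlist l)"
    have "\<tau> \<in> set (assignments (subterms u) (vlist l))"
      unfolding \<tau>_def *(3) by (intro map_in_assignments subst_var_in_subterms) (simp add: set_vlist)
    moreover have "subst (lookup \<tau>) l = subst \<sigma> l" "subst (lookup \<tau>) r = subst \<sigma> r"
      unfolding \<tau>_def lookup_map using vars[OF *(2)] by (auto intro!: subst_cong simp: set_vlist)
    ultimately show ?rhs
      using * set_contexts by (intro bexI[of _ "(u, C)"] bexI[of _ "(l, r)"] bexI[of _ \<tau>]) auto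
  next
    assume ?rhs
    then show "rstep (set rs) s t"
      using rstep_iff_context_of[OF lhs n, of t] set_contexts by (metis prod.collapse)
  qed
qed

lemma peaks_cert_iff:
  assumes R: "is_trs (set rs)"
  shows "peaks_cert rs t \<longleftrightarrow> weakly_confluent_on (set rs) t"
proof -
  define Q where "Q n \<longleftrightarrow> (\<forall>p\<in>set (contexts n t). \<forall>q\<in>set rs. \<forall>\<sigma>\<in>set (assignments (subterms (fst p)) (vlist (fst q))).
        fst p \<noteq> subst (lookup \<sigma>) (fst q) \<or>
      (\<forall>p'\<in>set (contexts n t). \<forall>q'\<in>set rs. \<forall>\<sigma>'\<in>set (assignments (subterms (fst p')) (vlist (fst q'))).
        fst p' \<noteq> subst (lookup \<sigma>') (fst q') \<or>
        join_cert rs (fill n (subst (lookup \<sigma>) (snd q)) (snd p))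
          (fill n (subst (lookup \<sigma>') (snd q')) (snd p'))))" for n
  have "Q n \<longleftrightarrow> weakly_confluent_on (set rs) t" if "n \<notin> vars t" for n
    unfolding Q_def weakly_confluent_on_iff_joinable rstep_iff_assignment[OF R that]
      join_cert_iff[OF is_trs_nonvar_lhs[OF R]] by blast
  moreover have "peaks_cert rs t \<longleftrightarrow> (\<exists>n. n \<notin> vars t \<and> Q n)"
  proof -
    have "(\<forall>y\<in>set (vlist t). y \<noteq> n) \<longleftrightarrow> n \<notin> vars t" for n unfolding set_vlist by blast
    then show ?thesis unfolding peaks_cert_def Q_def by simp
  qed
  moreover have "\<exists>n. n \<notin> vars t" using finite_vars ex_new_if_finite infinite_UNIV_nat by metis
  ultimately show ?thesis by blast
qed

lemma RE_weakly_confluent_on: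
  "RE (\<lambda>z. is_trs (set (fst z)) \<and> weakly_confluent_on (set (fst z)) (snd z))"
proof -
  have "is_trs (set (fst z)) \<and> weakly_confluent_on (set (fst z)) (snd z) \<longleftrightarrow>
      is_trs_cert (fst z) \<and> peaks_cert (fst z) (snd z)" for z
    using peaks_cert_iff by (auto simp: is_trs_cert_iff)
  then show ?thesis
    by (simp add: RE_conj RE_is_trs_cert[OF cmp_fst[OF cmp_id]] RE_peaks_cert)
qed

lemma RE_ground: "RE (\<lambda>z :: (trm \<times> trm) list \<times> trm. ground (snd z))"
proof -
  have "ground t \<longleftrightarrow> vlist t = []" for t by (simp add: ground_def flip: set_vlist)
  moreover have "RE (\<lambda>z :: (trm \<times> trm) list \<times> trm. vlist (snd z) = [])"
    by (intro RE_intros cmp_term_intros)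
  ultimately show ?thesis by simp
qed

lemma WCR_set_in_Sigma01: "WCR_set \<in> Sigma01"
  using RE_imp_Sigma01[OF RE_weakly_confluent] unfolding WCR_set_def enc_trs_eq_enc .

lemma WCR_on_set_in_Sigma01: "WCR_on_set \<in> Sigma01"
  using RE_imp_Sigma01[OF RE_weakly_confluent_on]
  unfolding WCR_on_set_def enc_trs_eq_enc by (simp add: enc_trm_def)

lemma WCR_on_ground_set_in_Sigma01: "WCR_on_ground_set \<in> Sigma01"
proof -
  have "{enc z | z. is_trs (set (fst z)) \<and> weakly_confluent_on (set (fst z)) (snd z) \<and> ground (snd z)} \<in> Sigma01"
    using RE_imp_Sigma01[OF RE_conj[OF RE_weakly_confluent_on RE_ground]] by simp
  then show ?thesis
    unfolding WCR_on_ground_set_def enc_trs_eq_enc by (simp add: enc_trm_def conj_commute)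
qed

section \<open>A rewrite system that interprets recursive functions\<close>

text \<open>The symbols below \<open>20\<close> are constructors.  A state is a symbol from \<open>20\<close> to \<open>23\<close> applied to
  constructor terms, the last of which is a stack of pending continuations: \<open>Ev\<close> evaluates a program on
  an argument list, \<open>Evs\<close> a list of programs, \<open>Ret\<close> and \<open>Rets\<close> pass a value or a list of values to
  the stack.\<close>

abbreviation "Zero \<equiv> Fun 0 []"
abbreviation "Succ t \<equiv> Fun (Suc 0) [t]"
abbreviation "Nl \<equiv> Fun 2 []"
abbreviation "Cs s t \<equiv> Fun 3 [s, t]"
abbreviation "PZr \<equiv> Fun 4 []"
abbreviation "PSc \<equiv> Fun 5 []"
abbreviation "PPj i \<equiv> Fun 6 [i]"
abbreviation "PCn f gs \<equiv> Fun 7 [f, gs]"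
abbreviation "PPr f g \<equiv> Fun 8 [f, g]"
abbreviation "PMn f \<equiv> Fun 9 [f]"
abbreviation "KHalt \<equiv> Fun 10 []"
abbreviation "KCn f k \<equiv> Fun 11 [f, k]"
abbreviation "KArgs gs xs k \<equiv> Fun 12 [gs, xs, k]"
abbreviation "KCs v k \<equiv> Fun 13 [v, k]"
abbreviation "KPr g n xs k \<equiv> Fun 14 [g, n, xs, k]"
abbreviation "KMn f y xs k \<equiv> Fun 15 [f, y, xs, k]"
abbreviation "Done \<equiv> Fun 16 []"
abbreviation "Ev f xs k \<equiv> Fun 20 [f, xs, k]"
abbreviation "Ret v k \<equiv> Fun 21 [v, k]"
abbreviation "Evs gs xs k \<equiv> Fun 22 [gs, xs, k]"
abbreviation "Rets vs k \<equiv> Fun 23 [vs, k]"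
abbreviation "Start \<equiv> Fun 24 []"

definition interp_rules :: "(trm \<times> trm) list" where
  "interp_rules = (let a = Var 0; b = Var 1; c = Var 2; d = Var 3; e = Var 4 in
    [(Ev PZr a b, Ret Zero b),
     (Ev PSc (Cs a b) c, Ret (Succ a) c),
     (Ev (PPj Zero) (Cs a b) c, Ret a c),
     (Ev (PPj (Succ d)) (Cs a b) c, Ev (PPj d) b c),
     (Ev (PCn a b) c d, Evs b c (KCn a d)),
     (Evs Nl a b, Rets Nl b),
     (Evs (Cs a b) c d, Ev a c (KArgs b c d)),
     (Ret a (KArgs b c d), Evs b c (KCs a d)),
     (Rets a (KCs b c), Rets (Cs b a) c),
     (Rets a (KCn b c), Ev b a c),
     (Ev (PPr a b) (Cs Zero c) d, Ev a c d),
     (Ev (PPr a b) (Cs (Succ e) c) d, Ev (PPr a b) (Cs e c) (KPr b e c d)),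
     (Ret a (KPr b c d e), Ev b (Cs c (Cs a d)) e),
     (Ev (PMn a) b c, Ev a (Cs Zero b) (KMn a Zero b c)),
     (Ret Zero (KMn a b c d), Ret b d),
     (Ret (Succ e) (KMn a b c d), Ev a (Cs (Succ b) c) (KMn a (Succ b) c d)),
     (Ret a KHalt, Done)])"

text \<open>Root steps alone, without contexts: the machine behind the rewrite system, with which
  \<open>rstep\<close> agrees on states.\<close>

inductive mstep :: "trm \<Rightarrow> trm \<Rightarrow> bool" where
  mstepI: "(l, r) \<in> set interp_rules \<Longrightarrow> mstep (subst \<sigma> l) (subst \<sigma> r)"

lemma mstep_nth:
  assumes "i < length interp_rules"
    "s = subst ((!) ts) (fst (interp_rules ! i))" "t = subst ((!) ts) (snd (interp_rules ! i))"
  shows "mstep s t"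
  using mstepI[of "fst (interp_rules ! i)" "snd (interp_rules ! i)" "(!) ts"] assms by simp

lemma mstep_rules:
  "mstep (Ev PZr xs k) (Ret Zero k)"
  "mstep (Ev PSc (Cs x xs) k) (Ret (Succ x) k)"
  "mstep (Ev (PPj Zero) (Cs x xs) k) (Ret x k)"
  "mstep (Ev (PPj (Succ i)) (Cs x xs) k) (Ev (PPj i) xs k)"
  "mstep (Ev (PCn f gs) xs k) (Evs gs xs (KCn f k))"
  "mstep (Evs Nl xs k) (Rets Nl k)"
  "mstep (Evs (Cs g gs) xs k) (Ev g xs (KArgs gs xs k))"
  "mstep (Ret v (KArgs gs xs k)) (Evs gs xs (KCs v k))"
  "mstep (Rets vs (KCs v k)) (Rets (Cs v vs) k)"
  "mstep (Rets vs (KCn f k)) (Ev f vs k)"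
  "mstep (Ev (PPr f g) (Cs Zero xs) k) (Ev f xs k)"
  "mstep (Ev (PPr f g) (Cs (Succ n) xs) k) (Ev (PPr f g) (Cs n xs) (KPr g n xs k))"
  "mstep (Ret v (KPr g n xs k)) (Ev g (Cs n (Cs v xs)) k)"
  "mstep (Ev (PMn f) xs k) (Ev f (Cs Zero xs) (KMn f Zero xs k))"
  "mstep (Ret Zero (KMn f y xs k)) (Ret y k)"
  "mstep (Ret (Succ v) (KMn f y xs k)) (Ev f (Cs (Succ y) xs) (KMn f (Succ y) xs k))"
  "mstep (Ret v KHalt) Done"
  \<comment> \<open>Each list gives the values of the rule variables \<open>0\<close>,
    \<open>1\<close>, ... in numerical order.\<close>
  subgoal by (rule mstep_nth[of 0 _ "[xs, k]"]) (simp_all add: interp_rules_def Let_def)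
  subgoal by (rule mstep_nth[of 1 _ "[x, xs, k]"]) (simp_all add: interp_rules_def Let_def)
  subgoal by (rule mstep_nth[of 2 _ "[x, xs, k]"]) (simp_all add: interp_rules_def Let_def)
  subgoal by (rule mstep_nth[of 3 _ "[x, xs, k, i]"]) (simp_all add: interp_rules_def Let_def)
  subgoal by (rule mstep_nth[of 4 _ "[f, gs, xs, k]"]) (simp_all add: interp_rules_def Let_def)
  subgoal by (rule mstep_nth[of 5 _ "[xs, k]"]) (simp_all add: interp_rules_def Let_def)
  subgoal by (rule mstep_nth[of 6 _ "[g, gs, xs, k]"]) (simp_all add: interp_rules_def Let_def)
  subgoal by (rule mstep_nth[of 7 _ "[v, gs, xs, k]"]) (simp_all add: interp_rules_def Let_def)
  subgoal by (rule mstep_nth[of 8 _ "[vs, v, k]"]) (simp_all add: interp_rules_def Let_def)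
  subgoal by (rule mstep_nth[of 9 _ "[vs, f, k]"]) (simp_all add: interp_rules_def Let_def)
  subgoal by (rule mstep_nth[of 10 _ "[f, g, xs, k]"]) (simp_all add: interp_rules_def Let_def)
  subgoal by (rule mstep_nth[of 11 _ "[f, g, xs, k, n]"]) (simp_all add: interp_rules_def Let_def)
  subgoal by (rule mstep_nth[of 12 _ "[v, g, n, xs, k]"]) (simp_all add: interp_rules_def Let_def)
  subgoal by (rule mstep_nth[of 13 _ "[f, xs, k]"]) (simp_all add: interp_rules_def Let_def)
  subgoal by (rule mstep_nth[of 14 _ "[f, y, xs, k]"]) (simp_all add: interp_rules_def Let_def)
  subgoal by (rule mstep_nth[of 15 _ "[f, y, xs, k, v]"]) (simp_all add: interp_rules_def Let_def)
  subgoal by (rule mstep_nth[of 16 _ "[v]"]) (simp_all add: interp_rules_def Let_def)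
  done


text \<open>Different left-hand sides have no common instance, and an instance of one determines all
  variables of its right-hand side. This yields both determinism and the triviality of root
  overlaps.\<close>

lemma interp_rules_functional:
  "(l, r) \<in> set interp_rules \<Longrightarrow> (l', r') \<in> set interp_rules \<Longrightarrow> subst \<sigma> l = subst \<tau> l' \<Longrightarrow>
    subst \<sigma> r = subst \<tau> r'"
  by (auto simp: interp_rules_def Let_def)

lemma mstep_deterministic:
  assumes "mstep s t" "mstep s t'"
  shows "t = t'"
proof -
  obtain l r \<sigma> where 1: "(l, r) \<in> set interp_rules" "s = subst \<sigma> l" "t = subst \<sigma> r"
    using assms(1) by cases
  obtain l' r' \<sigma>' where 2: "(l', r') \<in> set interp_rules" "s = subst \<sigma>' l'" "t' = subst \<sigma>' r'"
    using assms(2) by cases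
  show ?thesis using interp_rules_functional[OF 1(1) 2(1)] 1 2 by metis
qed

fun ctor :: "trm \<Rightarrow> bool" where
  "ctor (Var x) \<longleftrightarrow> True"
| "ctor (Fun f ts) \<longleftrightarrow> f < 20 \<and> (\<forall>t\<in>set ts. ctor t)"

lemma interp_rules_lhs:
  "(l, r) \<in> set interp_rules \<Longrightarrow>
    \<exists>f ts. l = Fun f ts \<and> 20 \<le> f \<and> f < 24 \<and> (\<forall>t\<in>set ts. ctor t) \<and> vars r \<subseteq> vars l"
  by (auto simp: interp_rules_def Let_def)

definition state :: "trm \<Rightarrow> bool" where
  "state s \<longleftrightarrow> (\<exists>f ts. s = Fun f ts \<and> 20 \<le> f \<and> f < 24 \<and> (\<forall>t\<in>set ts. ctor t))"

lemma mstep_state: "mstep s t \<Longrightarrow> state s \<Longrightarrow> state t \<or> t = Done"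
proof (induction rule: mstep.induct)
  case (mstepI l r \<sigma>)
  then show ?case by (auto simp: interp_rules_def Let_def state_def)
qed

lemma mstep_Done: "\<not> mstep Done t"
proof
  assume "mstep Done t"
  then obtain l r \<sigma> where "(l, r) \<in> set interp_rules" "Done = subst \<sigma> l" by cases
  then show False using interp_rules_lhs[of l r] by auto
qed

text \<open>By determinism a run to \<open>Done\<close> must pass through any known successor; the
  step count makes inductions on the remaining run possible.\<close>

lemma relpowp_mstep_Done:
  assumes "(mstep ^^ n) s Done" "mstep s t"
  obtains m where "n = Suc m" "(mstep ^^ m) t Done"
proof (cases n)
  case 0
  then show thesis using assms mstep_Done by auto
next
  case (Suc m)
  then obtain u where "mstep s u" "(mstep ^^ m) u Done" using assms(1) by (metis relpowp_Suc_D2)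
  then show thesis using that Suc mstep_deterministic assms(2) by blast
qed

text \<open>The states in which \<open>eval\<close> has no rule for want of an argument; getting
  stuck there is what keeps halting and definedness equivalent.\<close>

lemma mstep_stuck:
  "\<not> mstep (Ev PSc Nl k) t" "\<not> mstep (Ev (PPj i) Nl k) t" "\<not> mstep (Ev (PPr f g) Nl k) t"
  by (auto simp: interp_rules_def Let_def elim!: mstep.cases)

lemma relpowp_mstep_stuck: "(\<And>t. \<not> mstep (Fun f ts) t) \<Longrightarrow> f \<noteq> 16 \<Longrightarrow> \<not> (mstep ^^ n) (Fun f ts) Done"
  by (cases n) (auto simp del: relpowp.simps(2) dest!: relpowp_Suc_D2)

section \<open>Correctness of the interpreter\<close>

fun num :: "nat \<Rightarrow> trm" where
  "num 0 = Zero"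
| "num (Suc n) = Succ (num n)"

fun tlist :: "trm list \<Rightarrow> trm" where
  "tlist [] = Nl"
| "tlist (t # ts) = Cs t (tlist ts)"

fun prog :: "recf \<Rightarrow> trm" where
  "prog Zr = PZr"
| "prog Sc = PSc"
| "prog (Pj i) = PPj (num i)"
| "prog (Cn f gs) = PCn (prog f) (tlist (map prog gs))"
| "prog (Pr f g) = PPr (prog f) (prog g)"
| "prog (Mn f) = PMn (prog f)"

abbreviation "nums xs \<equiv> tlist (map num xs)"
abbreviation "progs gs \<equiv> tlist (map prog gs)"

lemma mstep_eval: "eval p xs y \<Longrightarrow> mstep\<^sup>*\<^sup>* (Ev (prog p) (nums xs) k) (Ret (num y) k)"
proof (induction arbitrary: k rule: eval.induct)
  case (eval_Zr xs)
  show ?case by (auto intro: mstep_rules)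
next
  case (eval_Sc x xs)
  show ?case by (auto intro: mstep_rules)
next
  case (eval_Pj i xs)
  then show ?case
  proof (induction i arbitrary: xs)
    case 0
    then show ?case by (cases xs) (auto intro: mstep_rules)
  next
    case (Suc i)
    then obtain x xs' where "xs = x # xs'" "i < length xs'" by (cases xs) auto
    then show ?case
      using Suc.IH[of xs'] mstep_rules(4)[of "num i" "num x" "nums xs'" k]
      by (auto intro: converse_rtranclp_into_rtranclp)
  qed
next
  case (eval_Cn xs gs ys f y)
  have "mstep\<^sup>*\<^sup>* (Evs (progs gs) (nums xs) k) (Rets (nums ys) k)" for k
    using eval_Cn.IH(1)
  proof (induction gs ys arbitrary: k rule: list_all2_induct)
    case Nil
    show ?case by (auto intro: mstep_rules)
  next
    case (Cons g gs y ys)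
    let ?k = "KArgs (progs gs) (nums xs) k"
    have "mstep (Evs (progs (g # gs)) (nums xs) k) (Ev (prog g) (nums xs) ?k)"
      by (simp add: mstep_rules)
    also have "mstep\<^sup>*\<^sup>* (Ev (prog g) (nums xs) ?k) (Ret (num y) ?k)" using Cons.hyps(1) by blast
    also have "mstep (Ret (num y) ?k) (Evs (progs gs) (nums xs) (KCs (num y) k))"
      by (rule mstep_rules)
    also have "mstep\<^sup>*\<^sup>* \<dots> (Rets (nums ys) (KCs (num y) k))" by (rule Cons.IH)
    also have "mstep \<dots> (Rets (nums (y # ys)) k)" by (simp add: mstep_rules)
    finally show ?case .
  qed
  note Evs = this
  have "mstep (Ev (prog (Cn f gs)) (nums xs) k) (Evs (progs gs) (nums xs) (KCn (prog f) k))"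
    by (simp add: mstep_rules)
  also have "mstep\<^sup>*\<^sup>* \<dots> (Rets (nums ys) (KCn (prog f) k))" by (rule Evs)
  also have "mstep \<dots> (Ev (prog f) (nums ys) k)" by (rule mstep_rules)
  also have "mstep\<^sup>*\<^sup>* \<dots> (Ret (num y) k)" by (rule eval_Cn.IH)
  finally show ?case .
next
  case (eval_Pr0 f xs y g)
  have "mstep (Ev (prog (Pr f g)) (nums (0 # xs)) k) (Ev (prog f) (nums xs) k)"
    by (simp add: mstep_rules)
  then show ?case using eval_Pr0.IH by (rule converse_rtranclp_into_rtranclp)
next
  case (eval_PrS f g n xs r y)
  let ?k = "KPr (prog g) (num n) (nums xs) k"
  have "mstep (Ev (prog (Pr f g)) (nums (Suc n # xs)) k) (Ev (prog (Pr f g)) (nums (n # xs)) ?k)"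
    by (simp add: mstep_rules)
  also have "mstep\<^sup>*\<^sup>* \<dots> (Ret (num r) ?k)" by (rule eval_PrS.IH)
  also have "mstep \<dots> (Ev (prog g) (nums (n # r # xs)) k)" by (simp add: mstep_rules)
  also have "mstep\<^sup>*\<^sup>* \<dots> (Ret (num y) k)" by (rule eval_PrS.IH)
  finally show ?case .
next
  case (eval_Mn f y xs)
  let ?st = "\<lambda>j. Ev (prog f) (nums (j # xs)) (KMn (prog f) (num j) (nums xs) k)"
  have "mstep\<^sup>*\<^sup>* (?st 0) (?st j)" if "j \<le> y" for j
    using that
  proof (induction j)
    case (Suc j)
    then obtain v where v: "v \<noteq> 0" "\<And>k. mstep\<^sup>*\<^sup>* (Ev (prog f) (nums (j # xs)) k) (Ret (num v) k)"
      using eval_Mn.IH(2)[of j] by auto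
    obtain v' where "v = Suc v'" using v(1) by (cases v) auto
    then have "mstep (Ret (num v) (KMn (prog f) (num j) (nums xs) k)) (?st (Suc j))"
      by (simp add: mstep_rules)
    then show ?case using Suc v(2) by (meson Suc_leD rtranclp.rtrancl_into_rtrancl rtranclp_trans)
  qed simp
  then have "mstep\<^sup>*\<^sup>* (?st 0) (?st y)" by simp
  also have "mstep\<^sup>*\<^sup>* (?st y) (Ret (num 0) (KMn (prog f) (num y) (nums xs) k))"
    by (rule eval_Mn.IH(1))
  also have "mstep \<dots> (Ret (num y) k)" by (simp add: mstep_rules)
  finally have "mstep\<^sup>*\<^sup>* (?st 0) (Ret (num y) k)" .
  moreover have "mstep (Ev (prog (Mn f)) (nums xs) k) (?st 0)" by (simp add: mstep_rules)
  ultimately show ?case by (rule converse_rtranclp_into_rtranclp[rotated])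
qed

text \<open>Induction on the length of the run, simultaneously for programs, lists of programs and a
  minimisation loop that has reached candidate \<open>y\<close>. The bound \<open>m < n\<close>
  records that the run left for the continuation is strictly shorter, so the induction hypothesis
  also covers nested evaluations; the third part carries the invariant that all candidates below
  \<open>y\<close> gave nonzero values.\<close>

lemma eval_of_mstep_Done:
  "(\<forall>p xs k. (mstep ^^ n) (Ev (prog p) (nums xs) k) Done \<longrightarrow>
      (\<exists>v m. m < n \<and> eval p xs v \<and> (mstep ^^ m) (Ret (num v) k) Done)) \<and>
    (\<forall>gs xs k. (mstep ^^ n) (Evs (progs gs) (nums xs) k) Done \<longrightarrow>
      (\<exists>vs m. m < n \<and> list_all2 (\<lambda>g v. eval g xs v) gs vs \<and> (mstep ^^ m) (Rets (nums vs) k) Done)) \<and>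
    (\<forall>f y xs k. (mstep ^^ n) (Ev (prog f) (nums (y # xs)) (KMn (prog f) (num y) (nums xs) k)) Done \<longrightarrow>
      (\<forall>z<y. \<exists>v. eval f (z # xs) v \<and> v \<noteq> 0) \<longrightarrow>
      (\<exists>v m. m < n \<and> eval (Mn f) xs v \<and> (mstep ^^ m) (Ret (num v) k) Done))"
proof (induction n rule: less_induct)
  case (less n)
  have Ev_less: "\<exists>v j. j < m \<and> eval p xs v \<and> (mstep ^^ j) (Ret (num v) k) Done"
    if "m < n" "(mstep ^^ m) (Ev (prog p) (nums xs) k) Done" for m p xs k
    using less.IH[OF that(1)] that(2) by blast
  have Evs_less: "\<exists>vs j. j < m \<and> list_all2 (\<lambda>g v. eval g xs v) gs vs \<and> (mstep ^^ j) (Rets (nums vs) k) Done"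
    if "m < n" "(mstep ^^ m) (Evs (progs gs) (nums xs) k) Done" for m gs xs k
    using less.IH[OF that(1)] that(2) by blast
  have Mn_less: "\<exists>v j. j < m \<and> eval (Mn f) xs v \<and> (mstep ^^ j) (Ret (num v) k) Done"
    if "m < n" "(mstep ^^ m) (Ev (prog f) (nums (y # xs)) (KMn (prog f) (num y) (nums xs) k)) Done"
      "\<forall>z<y. \<exists>v. eval f (z # xs) v \<and> v \<noteq> 0" for m f y xs k
    using less.IH[OF that(1)] that(2,3) by blast
  have Ev: "\<exists>v m. m < n \<and> eval p xs v \<and> (mstep ^^ m) (Ret (num v) k) Done"
    if run: "(mstep ^^ n) (Ev (prog p) (nums xs) k) Done" for p xs k
  proof (cases p)
    case Zr
    obtain m where "n = Suc m" "(mstep ^^ m) (Ret (num 0) k) Done"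
      using relpowp_mstep_Done[OF run] mstep_rules(1) Zr by (metis num.simps(1) prog.simps(1))
    then show ?thesis using Zr eval_Zr by blast
  next
    case Sc
    show ?thesis
    proof (cases xs)
      case Nil
      then show ?thesis using run Sc relpowp_mstep_stuck[OF mstep_stuck(1)] by simp
    next
      case (Cons x xs')
      obtain m where "n = Suc m" "(mstep ^^ m) (Ret (num (Suc x)) k) Done"
        using relpowp_mstep_Done[OF run, of "Ret (num (Suc x)) k"] mstep_rules(2) Sc Cons by auto
      then show ?thesis using Sc Cons eval_Sc by blast
    qed
  next
    case (Pj i)
    show ?thesis
    proof (cases xs)
      case Nil
      then show ?thesis using run Pj relpowp_mstep_stuck[OF mstep_stuck(2)] by simp
    next
      case (Cons x xs')
      show ?thesis
      proof (cases i)
        case 0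
        obtain m where "n = Suc m" "(mstep ^^ m) (Ret (num x) k) Done"
          using relpowp_mstep_Done[OF run, of "Ret (num x) k"] mstep_rules(3) Pj Cons 0 by auto
        moreover have "eval p xs x" using Pj Cons 0 by (simp add: eval_Pj_eq)
        ultimately show ?thesis by blast
      next
        case (Suc i')
        obtain m where m: "n = Suc m" "(mstep ^^ m) (Ev (prog (Pj i')) (nums xs') k) Done"
          using relpowp_mstep_Done[OF run, of "Ev (prog (Pj i')) (nums xs') k"]
            mstep_rules(4) Pj Cons Suc by auto
        then obtain v j where v: "j < m" "eval (Pj i') xs' v" "(mstep ^^ j) (Ret (num v) k) Done"
          using Ev_less by (metis lessI)
        from v(2) have "i' < length xs'" "v = xs' ! i'" by (auto elim: eval_PjE)
        then have "eval p xs v" using Pj Cons Suc by (simp add: eval_Pj_eq)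
        then show ?thesis using v(1,3) m(1) less_SucI by blast
      qed
    qed
  next
    case (Cn f gs)
    obtain m where m: "n = Suc m" "(mstep ^^ m) (Evs (progs gs) (nums xs) (KCn (prog f) k)) Done"
      using relpowp_mstep_Done[OF run, of "Evs (progs gs) (nums xs) (KCn (prog f) k)"]
        mstep_rules(5) Cn by auto
    then obtain vs j where vs: "j < m" "list_all2 (\<lambda>g v. eval g xs v) gs vs"
      "(mstep ^^ j) (Rets (nums vs) (KCn (prog f) k)) Done"
      using Evs_less by (metis lessI)
    obtain i where i: "j = Suc i" "(mstep ^^ i) (Ev (prog f) (nums vs) k) Done"
      using relpowp_mstep_Done[OF vs(3) mstep_rules(10)] .
    have "i < n" using i(1) vs(1) m(1) by simp
    then obtain v h where "h < i" "eval f vs v" "(mstep ^^ h) (Ret (num v) k) Done"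
      using Ev_less i(2) by blast
    then show ?thesis using Cn eval_Cn[OF vs(2)] \<open>i < n\<close> less_trans by blast
  next
    case (Pr f g)
    show ?thesis
    proof (cases xs)
      case Nil
      then show ?thesis using run Pr relpowp_mstep_stuck[OF mstep_stuck(3)] by simp
    next
      case (Cons x xs')
      show ?thesis
      proof (cases x)
        case 0
        obtain m where m: "n = Suc m" "(mstep ^^ m) (Ev (prog f) (nums xs') k) Done"
          using relpowp_mstep_Done[OF run, of "Ev (prog f) (nums xs') k"]
            mstep_rules(11) Pr Cons 0 by auto
        then obtain v j where "j < m" "eval f xs' v" "(mstep ^^ j) (Ret (num v) k) Done"
          using Ev_less by (metis lessI)
        then show ?thesis using Pr Cons 0 m(1) eval_Pr0 less_SucI by blast
      next
        case (Suc x')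
        let ?k = "KPr (prog g) (num x') (nums xs') k"
        obtain m where m: "n = Suc m" "(mstep ^^ m) (Ev (prog (Pr f g)) (nums (x' # xs')) ?k) Done"
          using relpowp_mstep_Done[OF run, of "Ev (prog (Pr f g)) (nums (x' # xs')) ?k"]
            mstep_rules(12) Pr Cons Suc by auto
        then obtain r j where r: "j < m" "eval (Pr f g) (x' # xs') r" "(mstep ^^ j) (Ret (num r) ?k) Done"
          using Ev_less by (metis lessI)
        obtain i where i: "j = Suc i" "(mstep ^^ i) (Ev (prog g) (nums (x' # r # xs')) k) Done"
          using relpowp_mstep_Done[OF r(3) mstep_rules(13)] by auto
        have "i < n" using i(1) r(1) m(1) by simp
        then obtain v h where "h < i" "eval g (x' # r # xs') v" "(mstep ^^ h) (Ret (num v) k) Done"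
          using Ev_less i(2) by blast
        then show ?thesis using Pr Cons Suc eval_PrS[OF r(2)] \<open>i < n\<close> less_trans by blast
      qed
    qed
  next
    case (Mn f)
    obtain m where m: "n = Suc m"
      "(mstep ^^ m) (Ev (prog f) (nums (0 # xs)) (KMn (prog f) (num 0) (nums xs) k)) Done"
      using relpowp_mstep_Done[OF run, of "Ev (prog f) (nums (0 # xs)) (KMn (prog f) (num 0) (nums xs) k)"]
        mstep_rules(14) Mn by auto
    then show ?thesis using Mn_less[OF _ m(2)] Mn less_SucI by blast
  qed
  moreover have "\<exists>vs m. m < n \<and> list_all2 (\<lambda>g v. eval g xs v) gs vs \<and> (mstep ^^ m) (Rets (nums vs) k) Done"
    if run: "(mstep ^^ n) (Evs (progs gs) (nums xs) k) Done" for gs xs k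
  proof (cases gs)
    case Nil
    obtain m where "n = Suc m" "(mstep ^^ m) (Rets (nums []) k) Done"
      using relpowp_mstep_Done[OF run, of "Rets (nums []) k"] mstep_rules(6) Nil by auto
    then show ?thesis using Nil by blast
  next
    case (Cons g gs')
    let ?k = "KArgs (progs gs') (nums xs) k"
    obtain m where m: "n = Suc m" "(mstep ^^ m) (Ev (prog g) (nums xs) ?k) Done"
      using relpowp_mstep_Done[OF run, of "Ev (prog g) (nums xs) ?k"] mstep_rules(7) Cons by auto
    then obtain v j where v: "j < m" "eval g xs v" "(mstep ^^ j) (Ret (num v) ?k) Done"
      using Ev_less by (metis lessI)
    obtain i where i: "j = Suc i" "(mstep ^^ i) (Evs (progs gs') (nums xs) (KCs (num v) k)) Done"
      using relpowp_mstep_Done[OF v(3) mstep_rules(8)] .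
    have "i < n" using i(1) v(1) m(1) by simp
    then obtain vs h where vs: "h < i" "list_all2 (\<lambda>g v. eval g xs v) gs' vs"
      "(mstep ^^ h) (Rets (nums vs) (KCs (num v) k)) Done"
      using Evs_less i(2) by blast
    obtain w where "h = Suc w" "(mstep ^^ w) (Rets (nums (v # vs)) k) Done"
      using relpowp_mstep_Done[OF vs(3) mstep_rules(9)] by auto
    moreover have "list_all2 (\<lambda>g v. eval g xs v) gs (v # vs)" using Cons v(2) vs(2) by simp
    moreover have "w < n" using \<open>h = Suc w\<close> vs(1) \<open>i < n\<close> by simp
    ultimately show ?thesis by blast
  qed
  moreover have "\<exists>v m. m < n \<and> eval (Mn f) xs v \<and> (mstep ^^ m) (Ret (num v) k) Done"
    if run: "(mstep ^^ n) (Ev (prog f) (nums (y # xs)) (KMn (prog f) (num y) (nums xs) k)) Done"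
      and nz: "\<forall>z<y. \<exists>v. eval f (z # xs) v \<and> v \<noteq> 0" for f y xs k
  proof -
    \<comment> \<open>\<open>Ev\<close> is already available at length \<open>n\<close> itself,
      since its own proof calls on the loop only for shorter runs.\<close>
    obtain v m where v: "m < n" "eval f (y # xs) v"
      "(mstep ^^ m) (Ret (num v) (KMn (prog f) (num y) (nums xs) k)) Done"
      using Ev[OF run] by blast
    show ?thesis
    proof (cases v)
      case 0
      obtain j where "m = Suc j" "(mstep ^^ j) (Ret (num y) k) Done"
        using relpowp_mstep_Done[OF v(3), of "Ret (num y) k"] mstep_rules(15) 0 by auto
      moreover have "eval (Mn f) xs y" using v(2) nz 0 by (auto intro: eval_Mn)
      ultimately show ?thesis using v(1) by (meson Suc_lessD)
    next
      case (Suc v')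
      obtain j where j: "m = Suc j"
        "(mstep ^^ j) (Ev (prog f) (nums (Suc y # xs)) (KMn (prog f) (num (Suc y)) (nums xs) k)) Done"
        using relpowp_mstep_Done[OF v(3),
            of "Ev (prog f) (nums (Suc y # xs)) (KMn (prog f) (num (Suc y)) (nums xs) k)"]
          mstep_rules(16) Suc by auto
      have "\<forall>z<Suc y. \<exists>v. eval f (z # xs) v \<and> v \<noteq> 0"
        using nz v(2) Suc by (metis less_SucE nat.distinct(1))
      moreover have "j < n" using j(1) v(1) by simp
      ultimately show ?thesis using Mn_less[OF _ j(2)] less_trans by blast
    qed
  qed
  ultimately show ?case by blast
qed

lemma eval_iff_mstep_Done: "(\<exists>v. eval p xs v) \<longleftrightarrow> mstep\<^sup>*\<^sup>* (Ev (prog p) (nums xs) KHalt) Done"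
proof
  assume "\<exists>v. eval p xs v"
  then show "mstep\<^sup>*\<^sup>* (Ev (prog p) (nums xs) KHalt) Done"
    using mstep_eval mstep_rules(17) by (metis rtranclp.rtrancl_into_rtrancl)
next
  assume "mstep\<^sup>*\<^sup>* (Ev (prog p) (nums xs) KHalt) Done"
  then obtain n where "(mstep ^^ n) (Ev (prog p) (nums xs) KHalt) Done" by (metis rtranclp_power)
  then show "\<exists>v. eval p xs v" using eval_of_mstep_Done[of n] by blast
qed

section \<open>Hardness\<close>

abbreviation run :: "recf \<Rightarrow> nat \<Rightarrow> trm" where
  "run p x \<equiv> Ev (prog p) (nums [x]) KHalt"

definition trs_of :: "recf \<Rightarrow> nat \<Rightarrow> (trm \<times> trm) list" where
  "trs_of p x = (Start, run p x) # (Start, Done) # interp_rules"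

lemma ctor_num: "ctor (num n)"
  by (induction n) auto

lemma ctor_tlist: "ctor (tlist ts) \<longleftrightarrow> (\<forall>t\<in>set ts. ctor t)"
  by (induction ts) auto

lemma ctor_prog: "ctor (prog p)"
  by (induction p) (auto simp: ctor_tlist ctor_num)

lemma vars_num: "vars (num n) = {}"
  by (induction n) auto

lemma vars_tlist: "vars (tlist ts) = (\<Union>t\<in>set ts. vars t)"
  by (induction ts) auto

lemma vars_prog: "vars (prog p) = {}"
  by (induction p) (auto simp: vars_num vars_tlist)

lemma state_run: "state (run p x)"
  by (auto simp: state_def ctor_prog ctor_num)

lemma subst_run: "subst \<sigma> (run p x) = run p x"
proof -
  have "subst \<sigma> (run p x) = subst Var (run p x)"
    by (rule subst_cong) (simp add: vars_prog vars_num)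
  then show ?thesis by (simp only: subst_Var)
qed

lemma trs_of_lhs:
  assumes "(l, r) \<in> set (trs_of p x)"
  obtains f ts where "l = Fun f ts" "20 \<le> f" "\<forall>t\<in>set ts. ctor t"
  using assms interp_rules_lhs[of l r] unfolding trs_of_def by auto

lemma is_trs_trs_of: "is_trs (set (trs_of p x))"
proof -
  have "(\<exists>f ts. l = Fun f ts) \<and> vars r \<subseteq> vars l" if "(l, r) \<in> set (trs_of p x)" for l r
    using that interp_rules_lhs[of l r] unfolding trs_of_def by (auto simp: vars_prog vars_num)
  then show ?thesis unfolding is_trs_def by auto
qed

lemma ctor_normal_form: "rstep (set (trs_of p x)) s t \<Longrightarrow> \<not> ctor s"
proof (induction rule: rstep.induct)
  case (root l r \<sigma>)
  then show ?case by (elim trs_of_lhs) auto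
qed auto

text \<open>The arguments of a state are constructor terms, hence normal forms, and its head differs
  from \<open>Start\<close>; only an interpreter rule at the root remains.\<close>

lemma rstep_state:
  assumes "rstep (set (trs_of p x)) s t" "state s"
  shows "mstep s t"
  using assms(1)
proof (cases rule: rstep.cases)
  case (root l r \<sigma>)
  then have "(l, r) \<in> set interp_rules" using assms(2) unfolding trs_of_def state_def by auto
  then show ?thesis using root mstepI by blast
next
  case (ctxt s' t' f ss us)
  then show ?thesis using assms(2) ctor_normal_form[OF ctxt(3)] unfolding state_def by auto
qed

lemma rsteps_run_Done:
  assumes "(rstep (set (trs_of p x)))\<^sup>*\<^sup>* s Done" "state s"
  shows "mstep\<^sup>*\<^sup>* s Done"
  using assms
proof (induction rule: converse_rtranclp_induct)
  case (step s t)
  have st: "mstep s t" using rstep_state step.hyps(1) step.prems by blast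
  then have "state t \<or> t = Done" using mstep_state step.prems by blast
  then have "mstep\<^sup>*\<^sup>* t Done" using step.IH by blast
  then show ?case using st by (rule converse_rtranclp_into_rtranclp[rotated])
qed simp

text \<open>\<open>Done\<close> is a normal form, so a common reduct of the peak can only be
  \<open>Done\<close>, and \<open>run p x\<close> must reach it.\<close>

lemma Start_peak:
  assumes "weakly_confluent_on (set (trs_of p x)) Start"
  shows "\<exists>v. eval p [x] v"
proof -
  let ?R = "set (trs_of p x)"
  have "rstep ?R Start (run p x)" "rstep ?R Start Done"
    using rstep.root[of Start "run p x" ?R Var] rstep.root[of Start Done ?R Var]
    by (simp_all only: subst_run) (simp_all add: trs_of_def)
  then obtain d where d: "(rstep ?R)\<^sup>*\<^sup>* (run p x) d" "(rstep ?R)\<^sup>*\<^sup>* Done d"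
    using assms unfolding weakly_confluent_on_def by blast
  from d(2) have "d = Done" by (cases rule: converse_rtranclpE) (auto dest: ctor_normal_form)
  then show ?thesis
    using rsteps_run_Done[OF _ state_run] d(1) eval_iff_mstep_Done[of p "[x]"] by simp
qed

lemma context_of_ctor: "context_of n t u C \<Longrightarrow> ctor t \<Longrightarrow> ctor u"
  by (induction rule: context_of.induct) auto

lemma ctor_subst_Var: "(\<And>x. \<exists>y. \<sigma> x = Var y) \<Longrightarrow> ctor t \<Longrightarrow> ctor (subst \<sigma> t)"
proof (induction t)
  case (Var x)
  then show ?case by (metis ctor.simps(1) subst.simps(1))
qed auto

text \<open>Proper subterms of left-hand sides are constructor terms and cannot unify with a
  left-hand side, so overlaps occur at the root only. At \<open>Start\<close> both reducts are among
  \<open>run p x\<close> and \<open>Done\<close>, which lead to \<open>Done\<close>; elsewhere the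
  reducts coincide.\<close>

lemma weakly_confluent_trs_of:
  assumes "eval p [x] v"
  shows "weakly_confluent (set (trs_of p x))"
  unfolding weakly_confluent_iff_overlaps_joinable overlaps_joinable_def
proof (intro allI impI)
  let ?R = "set (trs_of p x)"
  fix l r l' r' u C \<tau>
  assume lr: "(l, r) \<in> ?R" and lr': "(l', r') \<in> ?R" and C: "context_of 0 (ren_even l) u C"
    and eq: "subst \<tau> u = subst \<tau> (ren_odd l')"
  obtain f ts where l: "l = Fun f ts" "20 \<le> f" "\<forall>t\<in>set ts. ctor t" using lr by (rule trs_of_lhs)
  obtain f' ts' where l': "l' = Fun f' ts'" "20 \<le> f'" using lr' by (rule trs_of_lhs)
  have "\<exists>g us. u = Fun g us" using C by (induction rule: context_of.induct) auto
  then have "\<not> ctor u" using eq l' by auto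
  from C have "u = ren_even l \<and> C = Var 0"
  proof (cases rule: context_of.cases)
    case (context_arg t c g ss us)
    then have "t \<in> set (map ren_even ts)" using l(1) by auto
    then have "ctor t" using l(3) by (auto intro: ctor_subst_Var)
    then show ?thesis using context_arg context_of_ctor \<open>\<not> ctor u\<close> by blast
  qed (use l in auto)
  then have u: "u = ren_even l" and fill: "fill 0 (ren_odd r') C = ren_odd r'" by (simp_all add: fill_def)
  have "mstep\<^sup>*\<^sup>* (run p x) Done" using eval_iff_mstep_Done assms by blast
  moreover have "mstep s t \<Longrightarrow> rstep ?R s t" for s t
    by (induction rule: mstep.induct) (auto intro: rstep.root simp: trs_of_def)
  ultimately have run: "(rstep ?R)\<^sup>*\<^sup>* (run p x) Done" by (metis mono_rtranclp)
  show "joinable ?R (subst \<tau> (ren_even r)) (subst \<tau> (fill 0 (ren_odd r') C))"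
    unfolding fill
  proof (cases "l = Start")
    case True
    then have "l' = Start" using eq u l' by auto
    have Start: "subst \<tau> (subst \<sigma> s) \<in> {run p x, Done}" if "(Start, s) \<in> ?R" for \<sigma> s
    proof -
      have "s = run p x \<or> s = Done"
        using that interp_rules_lhs[of Start s] unfolding trs_of_def by auto
      then show ?thesis by (elim disjE) (simp_all only: subst_run, simp_all)
    qed
    have "subst \<tau> (ren_even r) \<in> {run p x, Done}" "subst \<tau> (ren_odd r') \<in> {run p x, Done}"
      using Start lr lr' True \<open>l' = Start\<close> by blast+
    moreover have "(rstep ?R)\<^sup>*\<^sup>* s Done" if "s \<in> {run p x, Done}" for s
      using that run by (elim insertE) (simp_all only: rtranclp.rtrancl_refl empty_iff)
    ultimately show "joinable ?R (subst \<tau> (ren_even r)) (subst \<tau> (ren_odd r'))"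
      by (intro joinableI)
  next
    case False
    then have "f \<noteq> 24" "l' \<noteq> Start"
      using lr interp_rules_lhs[of l r] l(1) eq u unfolding trs_of_def by auto
    then have "(l, r) \<in> set interp_rules" "(l', r') \<in> set interp_rules"
      using lr lr' False unfolding trs_of_def by auto
    from interp_rules_functional[OF this eq[unfolded u subst_subst]]
    have "subst \<tau> (ren_even r) = subst \<tau> (ren_odd r')" unfolding subst_subst .
    then show "joinable ?R (subst \<tau> (ren_even r)) (subst \<tau> (ren_odd r'))"
      unfolding joinable_def by auto
  qed
qed

section \<open>Computability of the reduction\<close>

lemma total_computable_enc_num: "total_computable (\<lambda>x. enc_term (num x))"
proof -
  have "enc_term (num x) = rec_nat (enc_term Zero)
      (\<lambda>_ r. prod_encode (1, prod_encode (Suc 0, Suc (prod_encode (r, 0))))) x" for x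
    by (induction x) simp_all
  then show ?thesis by (simp only:) (intro total_computable_intros)
qed

lemma total_computable_enc_trs_of: "total_computable (\<lambda>x. enc_trs (trs_of p x))"
proof -
  let ?c = "enc_trs ((Start, Done) # interp_rules)"
  \<comment> \<open>The encoding is unfolded just far enough to expose \<open>num x\<close>;
    everything else is constant for a fixed program \<open>p\<close>.\<close>
  have "enc_trs (trs_of p x) = Suc (prod_encode (prod_encode (enc_term Start, prod_encode (1,
      prod_encode (20, Suc (prod_encode (enc_term (prog p), Suc (prod_encode (
        prod_encode (1, prod_encode (3, Suc (prod_encode (enc_term (num x),
          Suc (prod_encode (enc_term Nl, 0)))))), Suc (prod_encode (enc_term KHalt, 0))))))))), ?c))" for x
    by (simp add: trs_of_def enc_trs_def)
  then show ?thesis by (simp only:) (intro total_computable_intros total_computable_enc_num)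
qed

lemma enc_trs_eq_iff: "enc_trs rs = enc_trs rs' \<longleftrightarrow> rs = rs'"
  by (simp add: enc_trs_eq_enc)

lemma enc_term_eq_iff: "enc_term s = enc_term t \<longleftrightarrow> s = t"
  using inj_enc_term by blast

lemma trs_of_in_WCR_set: "enc_trs (trs_of p x) \<in> WCR_set \<longleftrightarrow> (\<exists>v. eval p [x] v)"
  unfolding WCR_set_def using is_trs_trs_of weakly_confluent_trs_of Start_peak
  by (auto simp: enc_trs_eq_iff weakly_confluent_def)

lemma trs_of_in_WCR_on_set:
  "prod_encode (enc_trs (trs_of p x), enc_term Start) \<in> WCR_on_set \<longleftrightarrow> (\<exists>v. eval p [x] v)"
  unfolding WCR_on_set_def using is_trs_trs_of weakly_confluent_trs_of Start_peak
  by (auto simp: enc_trs_eq_iff enc_term_eq_iff weakly_confluent_def simp del: enc_term.simps)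

lemma trs_of_in_WCR_on_ground_set:
  "prod_encode (enc_trs (trs_of p x), enc_term Start) \<in> WCR_on_ground_set \<longleftrightarrow> (\<exists>v. eval p [x] v)"
  unfolding WCR_on_ground_set_def using is_trs_trs_of weakly_confluent_trs_of Start_peak
  by (auto simp: enc_trs_eq_iff enc_term_eq_iff weakly_confluent_def ground_def simp del: enc_term.simps)

lemma Sigma01_hard:
  assumes "\<And>p. total_computable (f p)" "\<And>p x. f p x \<in> B \<longleftrightarrow> (\<exists>v. eval p [x] v)"
  shows "\<forall>A\<in>Sigma01. many_one_reducible A B"
proof
  fix A assume "A \<in> Sigma01"
  then obtain p where "\<forall>x. x \<in> A \<longleftrightarrow> (\<exists>y. eval p [x] y)" unfolding Sigma01_def by blast
  then show "many_one_reducible A B" unfolding many_one_reducible_def using assms by blast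
qed

theorem theorem5:
  shows "complete_for Sigma01 WCR_set \<and>
         complete_for Sigma01 WCR_on_set \<and>
         complete_for Sigma01 WCR_on_ground_set"
proof -
  have on: "total_computable (\<lambda>x. prod_encode (enc_trs (trs_of p x), enc_term Start))" for p
    by (intro total_computable_intros total_computable_enc_trs_of)
  show ?thesis
    unfolding complete_for_def
    using WCR_set_in_Sigma01 Sigma01_hard[OF total_computable_enc_trs_of trs_of_in_WCR_set]
      WCR_on_set_in_Sigma01 Sigma01_hard[OF on trs_of_in_WCR_on_set]
      WCR_on_ground_set_in_Sigma01 Sigma01_hard[OF on trs_of_in_WCR_on_ground_set]
    by blast
qed

end
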